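(* Let $f:\mathbb{C}\to\mathbb{C}$ be an entire map and let $V$ be the grand orbit of a connected component of $\widehat{F}(f)$. Then the following are equivalent: (a) The grand orbit relation in $V$ is discrete. (b) There exists $z\in V$ such that $\mathrm{GO}(z)$ is discrete. (c) For each $z\in V$, there exists a neighborhood $U$ of $z$ such that $\mathrm{GO}(z')\cap U=\{z'\}$ for all $z'\in U$. If, in addition, $V$ is contained in the grand orbit of a wandering domain of $f$, then (a)–(c) are equivalent to (d) There exists a simply connected domain $W\subset V$ such that $f|_{f^n(W)}$ is injective for all $n\ge 0$.
   Context: $\mathbb{N}=\{0,1,2,\dots\}$ and $f^n$ is the $n$-th iterate. The Fatou set $F(f)$ is the set of points having a neighborhood on which $\{f^n\}$ is normal; a Fatou component is a connected component of $F(f)$; a wandering domain is a Fatou component that is neither periodic nor preperiodic. The grand orbit of a point is $\mathrm{GO}(z)=\{w\in\mathbb{C} : f^n(z)=f^m(w)\text{ for some } n,m\in\mathbb{N}\}$, and the grand orbit of a set $U$ is $\mathrm{GO}(U)=\bigcup_{z\in U}\mathrm{GO}(z)$. $S(f)$ is the set of singular values of $f$ (critical values, asymptotic values, and accumulation points of these) and $\mathrm{Per}(f)$ the set of periodic points. Put $\widehat{J}(f)=\overline{\mathrm{GO}(S(f)\cup \mathrm{Per}(f))}$ and $\widehat{F}(f)=\mathbb{C}\setminus\widehat{J}(f)$. For $V=\mathrm{GO}(U)$, the grand orbit relation in $V$ is the equivalence relation whose classes are grand orbits; it is discrete if $\mathrm{GO}(z)$ is a discrete set (every point of it is isolated in it)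 for all $z\in V$, and indiscrete otherwise. *)

theory Defs
  imports "HOL-Analysis.Analysis"
begin

text \<open>
  Inverse stereographic projection of the plane into the unit sphere of
  \<open>\<complex> \<times> \<real>\<close>, the point at infinity being \<open>(0, 1)\<close>.  The Euclidean distance
  of the images is the chordal distance on the Riemann sphere.
\<close>

definition to_sphere :: "complex \<Rightarrow> complex \<times> real" where
  "to_sphere z = ((2 / (1 + (cmod z)\<^sup>2)) *\<^sub>R z, ((cmod z)\<^sup>2 - 1) / ((cmod z)\<^sup>2 + 1))"

text \<open>
  Normality in the sense of Montel, with respect to the spherical metric: limit functions
  may take the value \<open>\<infinity>\<close>.  The limit \<open>h\<close> automatically takes its values on the sphere over \<open>U\<close>.
\<close>

definition normal_family_on :: "complex set \<Rightarrow> (complex \<Rightarrow> complex) set \<Rightarrow> bool" where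
  "normal_family_on U \<F> \<longleftrightarrow>
     (\<forall>g :: nat \<Rightarrow> complex \<Rightarrow> complex. range g \<subseteq> \<F> \<longrightarrow>
        (\<exists>r h. strict_mono (r :: nat \<Rightarrow> nat) \<and>
           (\<forall>K. compact K \<and> K \<subseteq> U \<longrightarrow>
              uniform_limit K (\<lambda>k z. to_sphere (g (r k) z)) h sequentially)))"

definition Fatou_set :: "(complex \<Rightarrow> complex) \<Rightarrow> complex set" where
  "Fatou_set f = {z. \<exists>U. open U \<and> z \<in> U \<and> normal_family_on U (range (\<lambda>n. f ^^ n))}"

text \<open>
  The component of the Fatou set containing \<open>f\<^sup>p(U)\<close> need not equal \<open>f\<^sup>p(U)\<close>
  (an omitted point may be missing), so periodicity of \<open>U\<close> means \<open>f\<^sup>p(U) \<subseteq> U\<close>.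
\<close>

definition periodic_component :: "(complex \<Rightarrow> complex) \<Rightarrow> complex set \<Rightarrow> bool" where
  "periodic_component f U \<longleftrightarrow> U \<in> components (Fatou_set f) \<and> (\<exists>p\<ge>1. (f ^^ p) ` U \<subseteq> U)"

definition preperiodic_component :: "(complex \<Rightarrow> complex) \<Rightarrow> complex set \<Rightarrow> bool" where
  "preperiodic_component f U \<longleftrightarrow> U \<in> components (Fatou_set f) \<and>
     (\<exists>m W. periodic_component f W \<and> (f ^^ m) ` U \<subseteq> W)"

definition wandering_domain :: "(complex \<Rightarrow> complex) \<Rightarrow> complex set \<Rightarrow> bool" where
  "wandering_domain f U \<longleftrightarrow> U \<in> components (Fatou_set f) \<and>
     \<not> periodic_component f U \<and> \<not> preperiodic_component f U"

definition GO :: "(complex \<Rightarrow> complex) \<Rightarrow> complex \<Rightarrow> complex set" where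
  "GO f z = {w. \<exists>n m. (f ^^ n) z = (f ^^ m) w}"

definition GO_set :: "(complex \<Rightarrow> complex) \<Rightarrow> complex set \<Rightarrow> complex set" where
  "GO_set f U = (\<Union>z\<in>U. GO f z)"

definition critical_values :: "(complex \<Rightarrow> complex) \<Rightarrow> complex set" where
  "critical_values f = f ` {c. deriv f c = 0}"

definition asymptotic_values :: "(complex \<Rightarrow> complex) \<Rightarrow> complex set" where
  "asymptotic_values f = {a. \<exists>\<gamma> :: real \<Rightarrow> complex. continuous_on {0..} \<gamma> \<and>
     filterlim \<gamma> at_infinity at_top \<and> ((\<lambda>t. f (\<gamma> t)) \<longlongrightarrow> a) at_top}"

definition singular_values :: "(complex \<Rightarrow> complex) \<Rightarrow> complex set" where
  "singular_values f = closure (critical_values f \<union> asymptotic_values f)"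

definition Per :: "(complex \<Rightarrow> complex) \<Rightarrow> complex set" where
  "Per f = {z. \<exists>p\<ge>1. (f ^^ p) z = z}"

definition J_hat :: "(complex \<Rightarrow> complex) \<Rightarrow> complex set" where
  "J_hat f = closure (GO_set f (singular_values f \<union> Per f))"

definition F_hat :: "(complex \<Rightarrow> complex) \<Rightarrow> complex set" where
  "F_hat f = UNIV - J_hat f"

definition discrete_GO_relation :: "(complex \<Rightarrow> complex) \<Rightarrow> complex set \<Rightarrow> bool" where
  "discrete_GO_relation f V \<longleftrightarrow> (\<forall>z\<in>V. discrete (GO f z))"

end

theory Submission
  imports Defs "HOL-Complex_Analysis.Complex_Analysis"
begin

text \<open>
  Call \<open>z\<close> separated (\<open>GO_separated_at\<close>) if (c) holds at \<open>z\<close>.  Since \<open>F_hat f\<close> is completely invariant and misses the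
  singular values, every relation \<open>f\<^sup>a(z) = f\<^sup>b(w)\<close> extends to a holomorphic transit map \<open>T\<close> with
  \<open>f\<^sup>b \<circ> T = f\<^sup>a\<close> and \<open>T(z) = w\<close> on any disc \<open>B \<subseteq> F_hat f\<close> around \<open>z\<close>; and since preperiodic
  points are removed, a transit map with a fixed point is the identity.  If \<open>z\<close> is not separated, there
  are transit maps \<open>T\<^sub>n \<noteq> id\<close> moving points near \<open>z\<close> to points near \<open>z\<close>.  They omit \<open>J_hat f\<close>, so
  Schottky's theorem makes them a normal family (affine \<open>f\<close> being treated directly), and a limit
  function fixes \<open>z\<close>.  By Hurwitz applied to \<open>T\<^sub>n - id\<close>, which has no zeros, the limit is the identity.
  Hence no \<open>u\<close> near \<open>z\<close> is isolated in its grand orbit.  So being separated is open and closed, and it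
  is equivalent to being isolated in one's own grand orbit.

  In a wandering domain \<open>f\<^sup>n(z) = f\<^sup>m(w)\<close> forces \<open>n = m\<close> for \<open>z, w\<close> in one component, so the
  injectivity in (d) says that \<open>W\<close> meets each grand orbit at most once.
\<close>

subsection \<open>Lifting holomorphic maps through an entire function\<close>

text \<open>Since \<open>f\<close> is invertible near \<open>u\<close>, the branch is the local
  inverse composed with \<open>h\<close>. The neighbourhood \<open>V\<close> on which
  \<open>f\<close> is injective is recorded so that another lift taking a value in \<open>V\<close>
  can be identified with \<open>k\<close>.\<close>

lemma local_branch:
  assumes f: "f holomorphic_on UNIV" and du: "deriv f u \<noteq> 0"
    and h: "h holomorphic_on B" and B: "open B" "\<zeta> \<in> B" and fu: "f u = h \<zeta>"
  obtains V \<epsilon> k where "open V" "u \<in> V" "inj_on f V" "\<epsilon> > 0" "ball \<zeta> \<epsilon> \<subseteq> B"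
    "k holomorphic_on ball \<zeta> \<epsilon>" "\<And>x. x \<in> ball \<zeta> \<epsilon> \<Longrightarrow> f (k x) = h x"
    "\<And>x. x \<in> ball \<zeta> \<epsilon> \<Longrightarrow> k x \<in> V" "k \<zeta> = u"
proof -
  obtain r where r: "r > 0" "open (f ` ball u r)" "inj_on f (ball u r)"
    using has_complex_derivative_locally_invertible[OF f UNIV_I open_UNIV du] by metis
  have fb: "f holomorphic_on ball u r"
    using f holomorphic_on_subset by blast
  obtain \<phi> where \<phi>: "\<phi> holomorphic_on (f ` ball u r)" "\<And>z. z \<in> ball u r \<Longrightarrow> \<phi> (f z) = z"
    using holomorphic_has_inverse[OF fb open_ball r(3)] by metis
  have "continuous_on B h"
    by (simp add: h holomorphic_on_imp_continuous_on)
  then have "open (B \<inter> h -` (f ` ball u r))"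
    using B(1) r(2) by (simp add: continuous_on_open_vimage inf_commute)
  moreover have "\<zeta> \<in> B \<inter> h -` (f ` ball u r)"
    using B(2) fu r(1) by (metis IntI centre_in_ball image_eqI vimageI)
  ultimately obtain \<epsilon> where \<epsilon>: "\<epsilon> > 0" "ball \<zeta> \<epsilon> \<subseteq> B \<inter> h -` (f ` ball u r)"
    using open_contains_ball by metis
  have inv: "f (\<phi> (h x)) = h x \<and> \<phi> (h x) \<in> ball u r" if "x \<in> ball \<zeta> \<epsilon>" for x
    using that \<epsilon>(2) \<phi>(2) by (smt (verit) IntD2 imageE subsetD vimageD)
  have "(\<phi> \<circ> h) holomorphic_on ball \<zeta> \<epsilon>"
  proof (rule holomorphic_on_compose_gen)
    show "h holomorphic_on ball \<zeta> \<epsilon>"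
      using h \<epsilon>(2) by (meson holomorphic_on_subset le_inf_iff)
  qed (use \<phi>(1) \<epsilon>(2) in auto)
  then show ?thesis
    using that[of "ball u r" \<epsilon> "\<phi> \<circ> h"] r \<epsilon> inv fu \<phi>(2)[of u] by auto
qed

text \<open>\<open>f\<close> is injective near \<open>g p\<close>, so by continuity both lifts
  coincide on a neighbourhood of \<open>p\<close>; the identity theorem spreads this over
  \<open>D\<close>.\<close>

lemma lift_unique:
  assumes f: "f holomorphic_on UNIV" and D: "open D" "connected D"
    and g: "g holomorphic_on D" "g' holomorphic_on D"
    and eq: "\<And>x. x \<in> D \<Longrightarrow> f (g x) = f (g' x)"
    and p: "p \<in> D" "g p = g' p" "deriv f (g p) \<noteq> 0" and x: "x \<in> D"
  shows "g x = g' x"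
proof -
  obtain r where r: "r > 0" "inj_on f (ball (g p) r)"
    using has_complex_derivative_locally_injective[OF f UNIV_I open_UNIV p(3)] by metis
  let ?A = "{x\<in>D. g x \<in> ball (g p) r} \<inter> {x\<in>D. g' x \<in> ball (g p) r}"
  have "open {x\<in>D. g x \<in> ball (g p) r}" "open {x\<in>D. g' x \<in> ball (g p) r}"
    using continuous_open_preimage[OF holomorphic_on_imp_continuous_on[OF g(1)] D(1) open_ball]
      continuous_open_preimage[OF holomorphic_on_imp_continuous_on[OF g(2)] D(1) open_ball]
    by (simp_all only: vimage_def Int_def mem_Collect_eq)
  then have A: "open ?A" "p \<in> ?A" "?A \<subseteq> D"
    using p r by auto
  have "g y = g' y" if "y \<in> ?A" for y
    using that r(2) eq by (auto simp: inj_on_def)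
  then show ?thesis
    using analytic_continuation_open[of ?A D g g' x] A D g x by blast
qed

text \<open>As \<open>v\<close> is not an asymptotic value, the path does not tend to infinity and
  has a finite cluster point \<open>u\<close>, with \<open>f u = v\<close>. As \<open>v\<close> is
  not a critical value, \<open>f\<close> stays away from \<open>v\<close> on small circles around
  \<open>u\<close>; the tail of the path cannot cross them and is trapped near
  \<open>u\<close>.\<close>

lemma path_limit_of_image_limit:
  fixes \<gamma> :: "real \<Rightarrow> complex"
  assumes f: "f holomorphic_on UNIV" and v: "v \<notin> singular_values f"
    and \<gamma>: "continuous_on {0..} \<gamma>" and lim: "((\<lambda>t. f (\<gamma> t)) \<longlongrightarrow> v) at_top"
  obtains u where "f u = v" "(\<gamma> \<longlongrightarrow> u) at_top"
proof -
  have contf: "continuous_on UNIV f"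
    by (simp add: f holomorphic_on_imp_continuous_on)
  have v': "v \<notin> critical_values f" "v \<notin> asymptotic_values f"
    using v closure_subset unfolding singular_values_def by auto
  then have "\<not> filterlim \<gamma> at_infinity at_top"
    using \<gamma> lim unfolding asymptotic_values_def by blast
  then obtain M where M: "\<not> eventually (\<lambda>t. M \<le> norm (\<gamma> t)) at_top"
    using filterlim_at_infinity[of 0 \<gamma> at_top] by auto
  then have "\<forall>n::nat. \<exists>t\<ge>real n. \<not> M \<le> norm (\<gamma> t)"
    by (simp add: eventually_at_top_linorder)
  then obtain T where T: "\<And>n. T n \<ge> real n" "\<And>n. norm (\<gamma> (T n)) < M"
    by (metis not_le)
  have "\<forall>n. \<gamma> (T n) \<in> cball 0 M"
    using T(2) by (simp add: less_imp_le)
  then obtain u r where u: "strict_mono (r :: nat \<Rightarrow> nat)" "((\<lambda>n. \<gamma> (T n)) \<circ> r) \<longlonglongrightarrow> u"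
    using seq_compactE[OF compact_imp_seq_compact[OF compact_cball]] by metis
  have Tinf: "filterlim (\<lambda>n. T (r n)) at_top sequentially"
    by (rule filterlim_at_top_mono[OF filterlim_compose[OF filterlim_real_sequentially filterlim_subseq[OF u(1)]]])
       (simp add: T(1))
  have "(\<lambda>n. f (\<gamma> (T (r n)))) \<longlonglongrightarrow> v"
    using filterlim_compose[OF lim Tinf] .
  moreover have "(\<lambda>n. f (\<gamma> (T (r n)))) \<longlonglongrightarrow> f u"
    using continuous_on_tendsto_compose[OF contf u(2)] by (simp add: o_def)
  ultimately have fu: "f u = v"
    using LIMSEQ_unique by blast
  then have "deriv f u \<noteq> 0"
    using v'(1) by (auto simp: critical_values_def)
  then obtain \<rho> where \<rho>: "\<rho> > 0" "inj_on f (ball u \<rho>)"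
    using has_complex_derivative_locally_injective[OF f UNIV_I open_UNIV] by metis
  have "eventually (\<lambda>t. dist (\<gamma> t) u < e) at_top" if "e > 0" for e
  proof -
    define s where "s = min (e/2) (\<rho>/2)"
    have s: "s > 0" "s < e" "s < \<rho>"
      using \<open>e > 0\<close> \<rho>(1) by (auto simp: s_def)
    have nv: "v \<noteq> f z" if "z \<in> sphere u s" for z
    proof
      assume "v = f z"
      then have "f z = f u" "z \<in> ball u \<rho>" "u \<in> ball u \<rho>"
        using that \<rho>(1) s fu by auto
      then have "z = u"
        by (rule inj_onD[OF \<rho>(2)])
      then show False
        using that s(1) by auto
    qed
    have "compact (f ` sphere u s)"
      by (intro compact_continuous_image continuous_on_subset[OF contf]) auto
    moreover have "v \<notin> f ` sphere u s"
      using nv by blast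
    ultimately obtain \<delta> where \<delta>: "\<delta> > 0" "\<And>y. y \<in> f ` sphere u s \<Longrightarrow> \<delta> \<le> dist v y"
      using separate_point_closed compact_imp_closed by metis
    have "eventually (\<lambda>t. dist (f (\<gamma> t)) v < \<delta>) at_top"
      using lim \<delta>(1) tendstoD by blast
    then obtain t0 where t0: "\<And>t. t \<ge> t0 \<Longrightarrow> dist (f (\<gamma> t)) v < \<delta>"
      by (auto simp: eventually_at_top_linorder)
    define t1 where "t1 = max 0 t0"
    have conn: "connected (\<gamma> ` {t1..})"
      by (intro connected_continuous_image continuous_on_subset[OF \<gamma>]) (auto simp: t1_def)
    have nosph: "\<gamma> ` {t1..} \<inter> frontier (ball u s) = {}"
    proof -
      have "\<gamma> t \<notin> sphere u s" if "t \<ge> t1" for t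
        using t0[of t] that \<delta>(2)[of "f (\<gamma> t)"] by (force simp: t1_def dist_commute)
      then show ?thesis
        using s(1) by (auto simp: frontier_ball)
    qed
    have "eventually (\<lambda>n. dist (\<gamma> (T (r n))) u < s) sequentially"
      using tendstoD[OF u(2) s(1)] by simp
    moreover have "eventually (\<lambda>n. T (r n) \<ge> t1) sequentially"
      using Tinf by (simp add: filterlim_at_top)
    ultimately have "eventually (\<lambda>n. dist (\<gamma> (T (r n))) u < s \<and> T (r n) \<ge> t1) sequentially"
      by (rule eventually_conj)
    then obtain n where n: "dist (\<gamma> (T (r n))) u < s" "T (r n) \<ge> t1"
      by (auto simp: eventually_sequentially)
    then have "\<gamma> ` {t1..} \<inter> ball u s \<noteq> {}"
      by (auto simp: dist_commute)
    then have "\<gamma> ` {t1..} \<subseteq> ball u s"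
      using connected_Int_frontier[OF conn] nosph by blast
    then have "\<forall>t\<ge>t1. dist (\<gamma> t) u < e"
      using s(2) by (force simp: dist_commute)
    then show ?thesis
      by (auto simp: eventually_at_top_linorder)
  qed
  then have "(\<gamma> \<longlongrightarrow> u) at_top"
    by (rule tendstoI)
  with fu show ?thesis using that by blast
qed

definition lift_on ::
    "(complex \<Rightarrow> complex) \<Rightarrow> (complex \<Rightarrow> complex) \<Rightarrow> complex \<Rightarrow> complex \<Rightarrow> complex set \<Rightarrow> (complex \<Rightarrow> complex) \<Rightarrow> bool"
  where "lift_on f h z0 w D g \<longleftrightarrow> open D \<and> convex D \<and> z0 \<in> D \<and> g holomorphic_on D \<and>
     (\<forall>x\<in>D. f (g x) = h x) \<and> g z0 = w"

text \<open>The lift is continued along segments issuing from \<open>z0\<close>. At a first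
  obstruction the lifted path would still have a limit, by \<open>path_limit_of_image_limit\<close>,
  and the local branch there carries the lift past it.\<close>

lemma holomorphic_lift_convex:
  assumes f: "f holomorphic_on UNIV" and B: "open B" "convex B" and h: "h holomorphic_on B"
    and hS: "h ` B \<inter> singular_values f = {}" and z0: "z0 \<in> B" and w: "f w = h z0"
  obtains g where "g holomorphic_on B" "\<And>x. x \<in> B \<Longrightarrow> f (g x) = h x" "g z0 = w"
proof -
  have nz: "deriv f u \<noteq> 0" if "f u = h x" "x \<in> B" for u x
  proof
    assume "deriv f u = 0"
    then have "f u \<in> critical_values f \<union> asymptotic_values f"
      by (simp add: critical_values_def)
    then have "f u \<in> singular_values f"
      unfolding singular_values_def by (rule subsetD[OF closure_subset])
    then show False using hS that by auto
  qed
  let ?L = "lift_on f h z0 w"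
  define \<D> where "\<D> = {D. D \<subseteq> B \<and> (\<exists>g. ?L D g)}"
  define \<Omega> where "\<Omega> = \<Union>\<D>"
  have agree: "g x = g' x" if "?L D g" "?L D' g'" "D \<subseteq> B" "x \<in> D" "x \<in> D'" for D D' g g' x
  proof (rule lift_unique[OF f, where D = "D \<inter> D'" and g = g and g' = g' and p = z0 and x = x])
    show "open (D \<inter> D')" "connected (D \<inter> D')" 
      using that by (auto simp: lift_on_def intro: convex_connected convex_Int)
    show "g holomorphic_on D \<inter> D'" "g' holomorphic_on D \<inter> D'" "z0 \<in> D \<inter> D'" "g z0 = g' z0" "x \<in> D \<inter> D'"
      using that by (auto simp: lift_on_def intro: holomorphic_on_subset)
    show "deriv f (g z0) \<noteq> 0"
      using nz[of "g z0" z0] that z0 by (auto simp: lift_on_def)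
  qed (use that in \<open>auto simp: lift_on_def\<close>)
  \<comment> \<open>Intersections of convex domains are connected, so lifts over convex domains containing \<open>z0\<close>
    are compatible and glue to \<open>G\<close> on the union \<open>\<Omega>\<close>.\<close>
  define G where "G x = (SOME y. \<exists>D g. D \<subseteq> B \<and> ?L D g \<and> x \<in> D \<and> y = g x)" for x
  have G: "G x = g x" if "?L D g" "D \<subseteq> B" "x \<in> D" for D g x
  proof -
    have "\<exists>D' g'. D' \<subseteq> B \<and> ?L D' g' \<and> x \<in> D' \<and> G x = g' x"
      unfolding G_def by (rule someI_ex) (use that in blast)
    then show ?thesis
      using agree that by metis
  qed
  have op: "open \<Omega>"
    unfolding \<Omega>_def \<D>_def lift_on_def by auto
  have \<Omega>B: "\<Omega> \<subseteq> B"
    unfolding \<Omega>_def \<D>_def by auto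
  have holG: "G holomorphic_on \<Omega>"
  proof (subst holomorphic_on_open[OF op], intro ballI)
    fix x assume "x \<in> \<Omega>"
    then obtain D g where D: "D \<subseteq> B" "?L D g" "x \<in> D"
      unfolding \<Omega>_def \<D>_def by auto
    then have "G holomorphic_on D"
      using G holomorphic_transform[of g D G] unfolding lift_on_def by metis
    then show "\<exists>f'. (G has_field_derivative f') (at x)"
      using D holomorphic_on_open unfolding lift_on_def by blast
  qed
  have fG: "f (G x) = h x" if "x \<in> \<Omega>" for x
    using that G unfolding \<Omega>_def \<D>_def lift_on_def by auto
  have z0\<Omega>: "z0 \<in> \<Omega>" and Gz0: "G z0 = w"
  proof -
    obtain V \<epsilon> k where "open V" "w \<in> V" "inj_on f V"
      and k: "\<epsilon> > 0" "ball z0 \<epsilon> \<subseteq> B" "k holomorphic_on ball z0 \<epsilon>"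
        "\<And>x. x \<in> ball z0 \<epsilon> \<Longrightarrow> f (k x) = h x" "\<And>x. x \<in> ball z0 \<epsilon> \<Longrightarrow> k x \<in> V" "k z0 = w"
      by (rule local_branch[OF f nz[OF w z0] h B(1) z0 w]) (rule that)
    then have L: "?L (ball z0 \<epsilon>) k"
      by (auto simp: lift_on_def)
    show "G z0 = w"
      using G[OF L k(2)] k by simp
    show "z0 \<in> \<Omega>"
      using L k(1,2) unfolding \<Omega>_def \<D>_def by (auto intro!: exI[of _ "ball z0 \<epsilon>"])
  qed
  have extend: "\<zeta> \<in> \<Omega>" if \<zeta>: "\<zeta> \<in> B"
    and seg: "\<And>t. 0 \<le> t \<Longrightarrow> t < 1 \<Longrightarrow> z0 + t *\<^sub>R (\<zeta> - z0) \<in> \<Omega>" for \<zeta>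
  proof -
    \<comment> \<open>The half-open segment is reparametrized by \<open>{0..}\<close>, the parameter
      ray used in the definition of asymptotic values.\<close>
    define \<sigma> where "\<sigma> s = z0 + (s / (1 + s)) *\<^sub>R (\<zeta> - z0)" for s :: real
    have \<sigma>\<Omega>: "\<sigma> s \<in> \<Omega>" if "s \<ge> 0" for s
      unfolding \<sigma>_def by (rule seg) (use that in \<open>auto simp: field_simps\<close>)
    have cont\<sigma>: "continuous_on {0..} \<sigma>"
      unfolding \<sigma>_def by (intro continuous_intros) auto
    have "((\<lambda>s::real. s / (1 + s)) \<longlongrightarrow> 1) at_top"
      by real_asymp
    then have "(\<sigma> \<longlongrightarrow> z0 + 1 *\<^sub>R (\<zeta> - z0)) at_top"
      unfolding \<sigma>_def by (intro tendsto_intros)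
    then have lim\<sigma>: "(\<sigma> \<longlongrightarrow> \<zeta>) at_top"
      by simp
    have conth: "continuous_on B h"
      by (simp add: h holomorphic_on_imp_continuous_on)
    have "continuous_on {0..} (\<lambda>s. G (\<sigma> s))"
      by (rule continuous_on_compose2[OF holomorphic_on_imp_continuous_on[OF holG] cont\<sigma>]) (use \<sigma>\<Omega> in auto)
    moreover have "((\<lambda>s. h (\<sigma> s)) \<longlongrightarrow> h \<zeta>) at_top"
    proof (rule continuous_on_tendsto_compose[OF conth lim\<sigma> \<zeta>])
      show "\<forall>\<^sub>F s in at_top. \<sigma> s \<in> B"
        using \<sigma>\<Omega> \<Omega>B by (auto simp: eventually_at_top_linorder)
    qed
    then have "((\<lambda>s. f (G (\<sigma> s))) \<longlongrightarrow> h \<zeta>) at_top"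
      by (rule Lim_transform_eventually)
         (use \<sigma>\<Omega> fG in \<open>auto simp: eventually_at_top_linorder intro!: exI[of _ 0]\<close>)
    moreover have "h \<zeta> \<notin> singular_values f"
      using hS \<zeta> by auto
    ultimately obtain u where u: "f u = h \<zeta>" "((\<lambda>s. G (\<sigma> s)) \<longlongrightarrow> u) at_top"
      using path_limit_of_image_limit[OF f] by metis
    obtain V \<epsilon> k where V: "open V" "u \<in> V" "inj_on f V" and \<epsilon>: "\<epsilon> > 0" "ball \<zeta> \<epsilon> \<subseteq> B"
      and k: "k holomorphic_on ball \<zeta> \<epsilon>" "\<And>x. x \<in> ball \<zeta> \<epsilon> \<Longrightarrow> f (k x) = h x"
        "\<And>x. x \<in> ball \<zeta> \<epsilon> \<Longrightarrow> k x \<in> V" "k \<zeta> = u"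
      by (rule local_branch[OF f nz[OF u(1) \<zeta>] h B(1) \<zeta> u(1)]) (rule that)
    have "\<forall>\<^sub>F s in at_top. G (\<sigma> s) \<in> V"
      using u(2) V(1,2) topological_tendstoD by blast
    moreover have "\<forall>\<^sub>F s in at_top. \<sigma> s \<in> ball \<zeta> \<epsilon>"
      using topological_tendstoD[OF lim\<sigma> open_ball] \<epsilon>(1) by simp
    ultimately have "\<forall>\<^sub>F s in at_top. s \<ge> 0 \<and> G (\<sigma> s) \<in> V \<and> \<sigma> s \<in> ball \<zeta> \<epsilon>"
      using eventually_ge_at_top[of "0::real"] by eventually_elim auto
    then obtain s where s: "s \<ge> 0" "G (\<sigma> s) \<in> V" "\<sigma> s \<in> ball \<zeta> \<epsilon>"
      by (auto simp: eventually_at_top_linorder)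
    define p where "p = \<sigma> s"
    have p: "p \<in> \<Omega>" "p \<in> ball \<zeta> \<epsilon>"
      using \<sigma>\<Omega> s by (auto simp: p_def)
    \<comment> \<open>Both values lie in \<open>V\<close>, where \<open>f\<close> is injective, and
      \<open>f\<close> maps both to \<open>h p\<close>.\<close>
    have Gp: "G p = k p"
      using V(3) s(2) k p fG by (auto simp: inj_on_def p_def)
    obtain D0 g0 where D0: "D0 \<subseteq> B" "?L D0 g0" "p \<in> D0"
      using p(1) unfolding \<Omega>_def \<D>_def by auto
    have g0k: "g0 x = k x" if "x \<in> D0" "x \<in> ball \<zeta> \<epsilon>" for x
    proof (rule lift_unique[OF f, where D = "D0 \<inter> ball \<zeta> \<epsilon>" and g = g0 and g' = k and p = p and x = x])
      show "open (D0 \<inter> ball \<zeta> \<epsilon>)" "connected (D0 \<inter> ball \<zeta> \<epsilon>)" 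
        using D0 by (auto simp: lift_on_def intro: convex_connected convex_Int)
      show "g0 holomorphic_on D0 \<inter> ball \<zeta> \<epsilon>" "k holomorphic_on D0 \<inter> ball \<zeta> \<epsilon>" 
        using D0 k(1) by (auto simp: lift_on_def intro: holomorphic_on_subset)
      show "p \<in> D0 \<inter> ball \<zeta> \<epsilon>" "x \<in> D0 \<inter> ball \<zeta> \<epsilon>" "g0 p = k p"
        using that p D0 Gp G[OF D0(2,1,3)] by auto
      show "deriv f (g0 p) \<noteq> 0"
        using nz[of "g0 p" p] D0 by (auto simp: lift_on_def)
      show "f (g0 y) = f (k y)" if "y \<in> D0 \<inter> ball \<zeta> \<epsilon>" for y
        using that D0(2) k(2) by (auto simp: lift_on_def)
    qed
    have "closed_segment z0 \<zeta> \<subseteq> D0 \<union> ball \<zeta> \<epsilon>"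
    proof -
      have "p \<in> closed_segment z0 \<zeta>"
        unfolding in_segment
      proof (intro exI conjI)
        show "p = (1 - s / (1 + s)) *\<^sub>R z0 + (s / (1 + s)) *\<^sub>R \<zeta>"
          unfolding p_def \<sigma>_def by (simp only: algebra_simps scaleR_one)
      qed (use s(1) in \<open>auto simp: field_simps\<close>)
      then have "closed_segment z0 \<zeta> = closed_segment z0 p \<union> closed_segment p \<zeta>"
        by (simp add: Un_closed_segment)
      moreover have "closed_segment z0 p \<subseteq> D0"
        using D0 by (intro closed_segment_subset) (auto simp: lift_on_def)
      moreover have "closed_segment p \<zeta> \<subseteq> ball \<zeta> \<epsilon>"
        using p \<epsilon>(1) by (intro closed_segment_subset) auto
      ultimately show ?thesis by auto
    qed
    moreover have "open (D0 \<union> ball \<zeta> \<epsilon>)"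
      using D0(2) by (auto simp: lift_on_def)
    ultimately obtain \<delta> where \<delta>: "\<delta> > 0" "(\<Union>x\<in>closed_segment z0 \<zeta>. ball x \<delta>) \<subseteq> D0 \<union> ball \<zeta> \<epsilon>"
      using compact_subset_open_imp_ball_epsilon_subset[OF compact_segment] by metis
    define D1 where "D1 = (\<Union>x\<in>closed_segment z0 \<zeta>. \<Union>y\<in>ball 0 \<delta>. {x + y})"
    have D1: "open D1" "convex D1"
      unfolding D1_def by (auto intro!: convex_sums open_sums)
    have D1sub: "D1 \<subseteq> D0 \<union> ball \<zeta> \<epsilon>"
    proof
      fix y assume "y \<in> D1"
      then obtain x e where "x \<in> closed_segment z0 \<zeta>" "e \<in> ball 0 \<delta>" "y = x + e"
        unfolding D1_def by auto
      then have "y \<in> (\<Union>x\<in>closed_segment z0 \<zeta>. ball x \<delta>)"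
        by (intro UN_I[of x]) (auto simp: dist_norm)
      then show "y \<in> D0 \<union> ball \<zeta> \<epsilon>"
        using \<delta>(2) by blast
    qed
    have inD1: "x \<in> D1" if "x \<in> closed_segment z0 \<zeta>" for x
      unfolding D1_def using that \<delta>(1) by (intro UN_I[of x] UN_I[of 0]) auto
    define g1 where "g1 x = (if x \<in> D0 then g0 x else k x)" for x
    have "g1 holomorphic_on D0"
      using D0(2) holomorphic_transform[of g0 D0 g1] by (auto simp: lift_on_def g1_def)
    moreover have "g1 holomorphic_on ball \<zeta> \<epsilon>"
      using k(1) holomorphic_transform[of k "ball \<zeta> \<epsilon>" g1] g0k by (auto simp: g1_def)
    ultimately have "g1 holomorphic_on D0 \<union> ball \<zeta> \<epsilon>"
      using D0(2) by (intro holomorphic_on_Un) (auto simp: lift_on_def)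
    then have "g1 holomorphic_on D1"
      using D1sub holomorphic_on_subset by blast
    moreover have "f (g1 x) = h x" if "x \<in> D1" for x
      using that D1sub D0(2) k(2) by (auto simp: g1_def lift_on_def)
    moreover have "g1 z0 = w"
      using D0(2) by (auto simp: lift_on_def g1_def)
    ultimately have "?L D1 g1"
      using D1 inD1 by (auto simp: lift_on_def)
    moreover have "D1 \<subseteq> B"
      using D1sub D0(1) \<epsilon>(2) by auto
    ultimately show "\<zeta> \<in> \<Omega>"
      using inD1[of \<zeta>] unfolding \<Omega>_def \<D>_def by auto
  qed
  have "B \<subseteq> \<Omega>"
  proof (rule subsetI, rule ccontr)
    fix \<zeta> assume \<zeta>: "\<zeta> \<in> B" "\<zeta> \<notin> \<Omega>"
    define c where "c t = z0 + t *\<^sub>R (\<zeta> - z0)" for t :: real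
    have contc: "continuous_on X c" for X
      unfolding c_def by (intro continuous_intros)
    \<comment> \<open>The parameters at which the segment is outside \<Omega>; the least one gives
      the point to which \<open>extend\<close> applies.\<close>
    define I where "I = {0..1} \<inter> c -` (- \<Omega>)"
    have "closed I"
      unfolding I_def using continuous_closed_vimage
      by (intro continuous_closed_preimage contc) (use op in auto)
    then have "compact I"
      unfolding I_def using compact_Int_closed by (metis I_def bounded_Int bounded_closed_interval compact_eq_bounded_closed)
    moreover have "1 \<in> I"
      using \<zeta> by (auto simp: I_def c_def)
    ultimately obtain m where m: "m \<in> I" "\<And>t. t \<in> I \<Longrightarrow> m \<le> t"
      using compact_attains_inf[of I] by auto
    have m01: "0 \<le> m" "m \<le> 1" and cm: "c m \<notin> \<Omega>"
      using m(1) by (auto simp: I_def)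
    have "c m \<in> B"
    proof -
      have "c m = (1 - m) *\<^sub>R z0 + m *\<^sub>R \<zeta>"
        by (simp add: c_def algebra_simps)
      then show ?thesis
        using convexD[OF B(2) z0 \<zeta>(1)] m01 by simp
    qed
    moreover have "z0 + t *\<^sub>R (c m - z0) \<in> \<Omega>" if "0 \<le> t" "t < 1" for t
    proof -
      have eq: "z0 + t *\<^sub>R (c m - z0) = c (t * m)"
        by (simp add: c_def)
      show ?thesis
      proof (cases "m = 0")
        case True
        then show ?thesis using z0\<Omega> eq by (simp add: c_def)
      next
        case False
        then have "t * m < m" "0 \<le> t * m"
          using that m01 by (auto simp: mult_less_cancel_right1)
        then show ?thesis
          using m(2)[of "t * m"] m01 that unfolding eq I_def by (auto simp: not_le)
      qed
    qed
    ultimately show False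
      using extend cm by blast
  qed
  then have "\<Omega> = B"
    using \<Omega>B by auto
  then show ?thesis
    using that holG fG Gz0 by auto
qed

subsection \<open>Grand orbits and their transit maps\<close>

lemma GO_refl [simp]: "z \<in> GO f z"
  unfolding GO_def by blast

lemma GO_sym: "w \<in> GO f z \<Longrightarrow> z \<in> GO f w"
  unfolding GO_def by (auto intro: sym)

lemma GO_trans:
  assumes "w \<in> GO f z" "v \<in> GO f w" shows "v \<in> GO f z"
proof -
  obtain n m n' m' where *: "(f ^^ n) z = (f ^^ m) w" "(f ^^ n') w = (f ^^ m') v"
    using assms by (auto simp: GO_def)
  have "(f ^^ (n' + n)) z = (f ^^ n') ((f ^^ m) w)"
    by (simp add: funpow_add * )
  also have "\<dots> = (f ^^ m) ((f ^^ n') w)"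
    by (metis add.commute comp_apply funpow_add)
  also have "\<dots> = (f ^^ (m + m')) v"
    by (simp add: funpow_add * )
  finally show ?thesis by (auto simp: GO_def)
qed

lemma GO_eq: "w \<in> GO f z \<Longrightarrow> GO f w = GO f z"
  using GO_trans GO_sym by blast

lemma funpow_in_GO [simp]: "(f ^^ n) z \<in> GO f z"
proof -
  have "(f ^^ n) z = (f ^^ 0) ((f ^^ n) z)"
    by simp
  then show ?thesis
    unfolding GO_def by blast
qed

lemma GO_set_closed: "w \<in> GO f z \<Longrightarrow> z \<in> GO_set f A \<Longrightarrow> w \<in> GO_set f A"
  unfolding GO_set_def using GO_trans by blast

lemma holomorphic_on_funpow:
  assumes "f holomorphic_on UNIV"
  shows "(f ^^ n) holomorphic_on A"
proof -
  have "(f ^^ n) holomorphic_on UNIV"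
  proof (induction n)
    case (Suc n)
    then show ?case
      using holomorphic_on_compose_gen[OF Suc assms] by (simp add: o_def)
  qed (simp add: id_def)
  then show ?thesis
    using holomorphic_on_subset by blast
qed

section \<open>Complete invariance of \<open>F_hat f\<close>\<close>

lemma F_hat_disjoint: "z \<in> F_hat f \<Longrightarrow> z \<notin> GO_set f (singular_values f \<union> Per f)"
  unfolding F_hat_def J_hat_def using closure_subset by blast

lemma open_F_hat: "open (F_hat f)"
  unfolding F_hat_def J_hat_def by (intro open_Diff open_UNIV closed_closure)

lemma F_hatI:
  assumes "open U" "z \<in> U" "U \<inter> GO_set f (singular_values f \<union> Per f) = {}"
  shows "z \<in> F_hat f"
proof -
  have "U \<inter> J_hat f = {}"
    using assms open_Int_closure_eq_empty unfolding J_hat_def by metis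
  then show ?thesis using assms by (auto simp: F_hat_def)
qed

lemma F_hat_not_singular: "z \<in> F_hat f \<Longrightarrow> z \<notin> singular_values f"
  using F_hat_disjoint unfolding GO_set_def by fastforce

text \<open>Two equal iterates at different times make the earlier one periodic, which puts
  \<open>z\<close> into the grand orbit of \<open>Per f\<close>.\<close>

lemma F_hat_not_preperiodic:
  assumes z: "z \<in> F_hat f" and eq: "(f ^^ n) z = (f ^^ m) z"
  shows "n = m"
proof -
  have *: False if eq: "(f ^^ a) z = (f ^^ b) z" and "a < b" for a b
  proof -
    have "(f ^^ (b - a)) ((f ^^ a) z) = (f ^^ b) z"
      using \<open>a < b\<close> by (metis add.commute comp_apply funpow_add le_add_diff_inverse less_imp_le)
    then have "(f ^^ a) z \<in> Per f"
      using eq \<open>a < b\<close> unfolding Per_def by (auto intro!: exI[of _ "b - a"])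
    moreover have "z \<in> GO f ((f ^^ a) z)"
      using funpow_in_GO GO_sym by metis
    ultimately have "z \<in> GO_set f (singular_values f \<union> Per f)"
      unfolding GO_set_def by blast
    then show False using F_hat_disjoint z by blast
  qed
  show ?thesis
    using *[of n m] *[of m n] eq by force
qed

lemma not_constant_if_F_hat:
  assumes "z \<in> F_hat f" shows "\<not> f constant_on UNIV"
proof
  assume "f constant_on UNIV"
  then have "(f ^^ 1) z = (f ^^ 2) z"
    by (auto simp: constant_on_def numeral_2_eq_2)
  then show False using F_hat_not_preperiodic assms by (metis one_eq_numeral_iff semiring_norm(83))
qed

text \<open>The grand orbit whose closure is \<open>J_hat f\<close> is completely invariant under
  \<open>f\<close>. Preimages of \<open>F_hat f\<close> are open by continuity and images by the
  open mapping theorem, so \<open>F_hatI\<close> applies in both directions.\<close>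

lemma F_hat_GO:
  assumes f: "f holomorphic_on UNIV" and z: "z \<in> F_hat f" and w: "w \<in> GO f z"
  shows "w \<in> F_hat f"
proof -
  let ?A = "GO_set f (singular_values f \<union> Per f)"
  have inv: "f y \<in> ?A \<longleftrightarrow> y \<in> ?A" for y
    using GO_set_closed[of "f y" f y] GO_set_closed[of y f "f y"] funpow_in_GO[of 1 f y] GO_sym[of "f y" f y]
    by auto
  have bwd: "y \<in> F_hat f" if "f y \<in> F_hat f" for y
  proof (rule F_hatI)
    show "open (f -` F_hat f)"
      using open_vimage[OF open_F_hat holomorphic_on_imp_continuous_on[OF f]] .
    show "f -` F_hat f \<inter> ?A = {}"
      using F_hat_disjoint inv by blast
  qed (use that in auto)
  have fwd: "f y \<in> F_hat f" if "y \<in> F_hat f" for y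
  proof (rule F_hatI)
    show "open (f ` F_hat f)"
      using open_mapping_thm[OF f open_UNIV connected_UNIV open_F_hat subset_UNIV] not_constant_if_F_hat z by blast
    show "f ` F_hat f \<inter> ?A = {}"
      using F_hat_disjoint inv by blast
  qed (use that in auto)
  have forwn: "(f ^^ n) y \<in> F_hat f" if "y \<in> F_hat f" for n y
    using that by (induction n) (auto intro: fwd)
  have backn: "(f ^^ n) y \<in> F_hat f \<Longrightarrow> y \<in> F_hat f" for n y
    by (induction n) (auto intro: bwd)
  from w obtain n m where "(f ^^ n) z = (f ^^ m) w"
    by (auto simp: GO_def)
  then show ?thesis
    using forwn[OF z, of n] backn[of m w] by simp
qed

text \<open>A critical point on the orbit would produce a critical value in \<open>F_hat f\<close>;
  the chain rule does the rest.\<close>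

lemma deriv_funpow_nz:
  assumes f: "f holomorphic_on UNIV" and z: "z \<in> F_hat f"
  shows "deriv (f ^^ n) z \<noteq> 0"
proof (induction n)
  case 0
  then show ?case by (simp add: id_def)
next
  case (Suc n)
  have "(f ^^ Suc n) z \<in> F_hat f"
    using F_hat_GO[OF f z] funpow_in_GO by metis
  then have "(f ^^ Suc n) z \<notin> critical_values f \<union> asymptotic_values f"
    using F_hat_not_singular closure_subset unfolding singular_values_def by blast
  then have "deriv f ((f ^^ n) z) \<noteq> 0"
    by (auto simp: critical_values_def)
  moreover have "f field_differentiable at x" "(f ^^ n) field_differentiable at x" for x
    using f holomorphic_on_funpow[OF f, of n UNIV] holomorphic_on_imp_differentiable_at open_UNIV by blast+
  ultimately show ?case
    using Suc deriv_chain[of "f ^^ n" z f] by (simp add: o_def)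
qed

text \<open>\<open>T\<close> is a branch of the inverse of \<open>f ^^ b\<close> composed with
  \<open>f ^^ a\<close>. Keeping its values in \<open>F_hat f\<close> allows it to be lifted once
  more and makes it omit \<open>J_hat f\<close>.\<close>

definition transit ::
    "(complex \<Rightarrow> complex) \<Rightarrow> nat \<Rightarrow> nat \<Rightarrow> complex set \<Rightarrow> (complex \<Rightarrow> complex) \<Rightarrow> bool"
  where "transit f a b B T \<longleftrightarrow> T holomorphic_on B \<and> T ` B \<subseteq> F_hat f \<and> (\<forall>x\<in>B. (f ^^ b) (T x) = (f ^^ a) x)"

lemma transit_GO: "transit f a b B T \<Longrightarrow> x \<in> B \<Longrightarrow> T x \<in> GO f x"
  unfolding transit_def GO_def mem_Collect_eq by metis

text \<open>Induction on \<open>b\<close>, lifting through one copy of \<open>f\<close> at a time,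
  so that only singular values of \<open>f\<close> itself have to be avoided.\<close>

lemma transit_exists:
  assumes f: "f holomorphic_on UNIV" and B: "open B" "convex B" "B \<subseteq> F_hat f"
    and z: "z \<in> B" and eq: "(f ^^ a) z = (f ^^ b) w"
  obtains T where "transit f a b B T" "T z = w"
proof -
  have "\<exists>T. transit f a b B T \<and> T z = w"
    using eq
  proof (induction b arbitrary: w)
    case 0
    have "(f ^^ a) ` B \<subseteq> F_hat f"
      using B(3) F_hat_GO[OF f _ funpow_in_GO] by blast
    then show ?case
      using holomorphic_on_funpow[OF f] 0 by (intro exI[of _ "f ^^ a"]) (auto simp: transit_def)
  next
    case (Suc b)
    have "(f ^^ a) z = (f ^^ b) (f w)"
      using Suc.prems by (simp add: funpow_swap1)
    then obtain T where T: "transit f a b B T" "T z = f w"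
      using Suc.IH by blast
    have "T ` B \<inter> singular_values f = {}"
      using T(1) F_hat_not_singular by (auto simp: transit_def)
    then obtain g where g: "g holomorphic_on B" "\<And>x. x \<in> B \<Longrightarrow> f (g x) = T x" "g z = w"
      using holomorphic_lift_convex[OF f B(1,2) _ _ z] T unfolding transit_def by metis
    have "g x \<in> F_hat f" if "x \<in> B" for x
    proof -
      have "g x \<in> GO f (f (g x))"
        using GO_sym[OF funpow_in_GO[of 1 f "g x"]] by simp
      moreover have "f (g x) \<in> F_hat f"
        using g(2)[OF that] T(1) that by (auto simp: transit_def)
      ultimately show ?thesis
        using F_hat_GO[OF f] by blast
    qed
    moreover have "(f ^^ Suc b) (g x) = (f ^^ a) x" if "x \<in> B" for x
      using that g(2) T(1) by (simp add: funpow_swap1 transit_def)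
    ultimately show ?case
      using g by (intro exI[of _ g]) (auto simp: transit_def)
  qed
  then show ?thesis using that by blast
qed

text \<open>A fixed point forces \<open>a = b\<close>, because points of \<open>F_hat f\<close> are
  not preperiodic. Then \<open>T\<close> and the identity are two lifts of \<open>f ^^ a\<close>
  through itself that agree at \<open>z\<close>.\<close>

lemma transit_fixpoint:
  assumes f: "f holomorphic_on UNIV" and B: "open B" "connected B" "B \<subseteq> F_hat f"
    and T: "transit f a b B T" and z: "z \<in> B" "T z = z" and x: "x \<in> B"
  shows "T x = x"
proof -
  have "(f ^^ b) z = (f ^^ a) z"
    using T z unfolding transit_def by metis
  then have ab: "b = a"
    using F_hat_not_preperiodic B z by blast
  have "T x = id x"
  proof (rule lift_unique[OF holomorphic_on_funpow[OF f], where D = B and g = T and g' = id and p = z])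
    show "deriv (f ^^ a) (T z) \<noteq> 0"
      using deriv_funpow_nz[OF f] B z by auto
  qed (use T B z x ab in \<open>auto simp: transit_def id_def\<close>)
  then show ?thesis by simp
qed

section \<open>Uniform bounds for transit maps\<close>

lemma Per_subset_J_hat: "Per f \<subseteq> J_hat f"
proof
  fix x assume "x \<in> Per f"
  then have "x \<in> GO_set f (singular_values f \<union> Per f)"
    unfolding GO_set_def by (intro UN_I[of x]) auto
  then show "x \<in> J_hat f"
    unfolding J_hat_def by (rule subsetD[OF closure_subset])
qed

text \<open>This settles the exceptional case in which \<open>J_hat f\<close> does not supply the
  two omitted values for Schottky's theorem.\<close>

lemma affine_if_small_J_hat:
  assumes f: "f holomorphic_on UNIV" and small: "\<And>p q. p \<in> J_hat f \<Longrightarrow> q \<in> J_hat f \<Longrightarrow> p = q"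
  obtains c d where "\<And>z. f z = c * z + d"
proof (cases "\<exists>a. f = (\<lambda>x. a + x)")
  case True
  then obtain a where "f = (\<lambda>x. a + x)" by blast
  then show ?thesis using that[of 1 a] by simp
next
  case False
  \<comment> \<open>An entire map other than a translation has a point fixed by its second iterate.
    It turns out to be fixed by \<open>f\<close>, because its grand orbit reduces to itself.\<close>
  then obtain p where p: "f (f p) = p"
    using holomorphic_involution_point[OF f] by metis
  have per: "p \<in> Per f"
    using p unfolding Per_def by (auto intro!: exI[of _ 2] simp: numeral_2_eq_2)
  then have pJ: "p \<in> J_hat f"
    using Per_subset_J_hat by auto
  have GOp: "z = p" if "z \<in> GO f p" for z
  proof (rule small[OF _ pJ])
    have "z \<in> GO_set f (singular_values f \<union> Per f)"
      unfolding GO_set_def using that per by blast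
    then show "z \<in> J_hat f"
      unfolding J_hat_def by (rule subsetD[OF closure_subset])
  qed
  have fp: "f p = p"
    using GOp[OF funpow_in_GO[of 1]] by simp
  have pre: "z = p" if "f z = p" for z
    using GOp[of z] GO_sym[OF funpow_in_GO[of 1 f z]] that by simp
  have fix': "z = p" if "f z = z" for z
  proof (rule small[OF _ pJ])
    have "z \<in> Per f"
      using that unfolding Per_def by (auto intro!: exI[of _ 1])
    then show "z \<in> J_hat f"
      using Per_subset_J_hat by auto
  qed
  \<comment> \<open>\<open>f\<close> has no fixed point and no preimage of \<open>p\<close> other than \<open>p\<close>, so composing with \<open>exp\<close>
    gives an entire function that omits \<open>0\<close> and \<open>1\<close>.\<close>
  obtain c where c: "(\<lambda>w. (f (p + exp w) - p) / exp w) = (\<lambda>w. c)"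
  proof (rule little_Picard_01)
    show "(\<lambda>w. (f (p + exp w) - p) / exp w) holomorphic_on UNIV"
      by (intro holomorphic_intros holomorphic_on_compose_gen[OF _ f, unfolded o_def]) auto
    show "(f (p + exp w) - p) / exp w \<noteq> 0 \<and> (f (p + exp w) - p) / exp w \<noteq> 1" for w
      using pre[of "p + exp w"] fix'[of "p + exp w"] by (auto simp: field_simps)
  qed
  have "f z = c * z + (p - c * p)" for z
  proof (cases "z = p")
    case False
    then have "exp (Ln (z - p)) = z - p"
      by simp
    with fun_cong[OF c, of "Ln (z - p)"] False show ?thesis
      by (simp add: field_simps)
  qed (simp add: fp)
  then show ?thesis using that by blast
qed

text \<open>The bound is uniform in \<open>a\<close>, \<open>b\<close> and \<open>T\<close>, as
  Montel's theorem will require. If \<open>J_hat f\<close> has two points, transit maps omit both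
  and Schottky's theorem applies; otherwise \<open>f\<close> is affine, and so are its transit
  maps.\<close>

lemma transit_bounded:
  assumes f: "f holomorphic_on UNIV" and r: "r > 0" "ball x (4 * r) \<subseteq> F_hat f"
  obtains K where "\<And>a b T z y. transit f a b (ball x (4 * r)) T \<Longrightarrow> z \<in> ball x r \<Longrightarrow> cmod (T z) \<le> M
    \<Longrightarrow> y \<in> ball x r \<Longrightarrow> cmod (T y) \<le> K"
proof (cases "\<exists>p q. p \<in> J_hat f \<and> q \<in> J_hat f \<and> p \<noteq> q")
  case True
  then obtain p q where pq: "p \<in> J_hat f" "q \<in> J_hat f" "p \<noteq> q" by blast
  define R where "R = (M + cmod p) / cmod (q - p)"
  \<comment> \<open>Schottky's bound on the disc of radius 2/3 for functions that omit 0 and 1 and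
    have modulus at most \<open>R\<close> at 0.\<close>
  define E where "E = exp (pi * exp (pi * (2 + 2 * R + 12 * (2/3) / (1 - 2/3))))"
  have "cmod (T y) \<le> E * cmod (q - p) + cmod p"
    if T: "transit f a b (ball x (4 * r)) T" and z: "z \<in> ball x r" "cmod (T z) \<le> M" and y: "y \<in> ball x r"
    for a b T z y
  proof -
    \<comment> \<open>Rescaling to the unit disc: the closed disc of radius \<open>3 * r\<close>
      about \<open>z\<close> stays inside \<open>ball x (4 * r)\<close>, and \<open>y\<close>, at
      distance at most \<open>2 * r\<close> from \<open>z\<close>, lands at modulus at most 2/3. The
      omitted values become 0 and 1.\<close>
    define g where "g \<zeta> = (T (z + of_real r * 3 * \<zeta>) - p) / (q - p)" for \<zeta>
    have in_ball: "z + of_real r * 3 * \<zeta> \<in> ball x (4 * r)" if "\<zeta> \<in> cball 0 1" for \<zeta>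
    proof -
      have "dist x (z + of_real r * 3 * \<zeta>) \<le> dist x z + dist z (z + of_real r * 3 * \<zeta>)"
        by (rule dist_triangle)
      also have "dist z (z + of_real r * 3 * \<zeta>) = r * 3 * cmod \<zeta>"
        using r(1) by (simp add: dist_norm norm_mult)
      also have "\<dots> \<le> 3 * r"
        using that r(1) by simp
      finally show ?thesis using z(1) by simp
    qed
    have omit: "T u \<noteq> p \<and> T u \<noteq> q" if "u \<in> ball x (4 * r)" for u
    proof -
      have "T u \<notin> J_hat f"
        using T that unfolding transit_def F_hat_def by blast
      then show ?thesis using pq by auto
    qed
    define \<zeta> where "\<zeta> = (y - z) / (of_real r * 3)"
    have "cmod (y - z) \<le> 2 * r"
      using y z(1) dist_triangle[of y z x] by (simp add: dist_norm norm_minus_commute)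
    then have \<zeta>: "cmod \<zeta> \<le> 2/3" "z + of_real r * 3 * \<zeta> = y"
      using r(1) by (auto simp: \<zeta>_def norm_divide norm_mult field_simps)
    have "cmod (g \<zeta>) \<le> E"
      unfolding E_def
    proof (rule Schottky[where f = g and z = \<zeta>])
      have "T \<circ> (\<lambda>\<zeta>. z + of_real r * 3 * \<zeta>) holomorphic_on cball 0 1"
      proof (rule holomorphic_on_compose_gen)
        show "T holomorphic_on ball x (4 * r)"
          using T by (simp add: transit_def)
      qed (use in_ball in \<open>auto intro!: holomorphic_intros\<close>)
      then have "(\<lambda>\<zeta>. T (z + of_real r * 3 * \<zeta>)) holomorphic_on cball 0 1"
        by (simp add: o_def)
      then show "g holomorphic_on cball 0 1"
        unfolding g_def using pq(3) by (intro holomorphic_intros) auto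
      show "cmod (g 0) \<le> R"
        unfolding g_def R_def using z(2) norm_triangle_ineq4[of "T z" p]
        by (auto simp: norm_divide intro!: divide_right_mono)
      show "\<And>u. u \<in> cball 0 1 \<Longrightarrow> \<not> (g u = 0 \<or> g u = 1)"
        unfolding g_def using omit[OF in_ball] pq(3) by (auto simp: field_simps)
    qed (use \<zeta> in auto)
    moreover have "T y = g \<zeta> * (q - p) + p"
      unfolding g_def \<zeta>(2) using pq(3) by simp
    then have "cmod (T y) \<le> cmod (g \<zeta>) * cmod (q - p) + cmod p"
      by (metis norm_mult norm_triangle_ineq)
    ultimately show ?thesis
      by (smt (verit) mult_right_mono norm_ge_zero)
  qed
  then show ?thesis using that by blast
next
  case False
  then obtain c d where cd: "\<And>z. f z = c * z + d"
    using affine_if_small_J_hat[OF f] by metis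
  have "x \<in> F_hat f"
    using r by auto
  then have "\<not> f constant_on UNIV"
    by (rule not_constant_if_F_hat)
  then have c0: "c \<noteq> 0"
    using cd by (auto simp: constant_on_def)
  have diff: "(f ^^ n) u - (f ^^ n) v = c ^ n * (u - v)" for n u v
  proof (induction n)
    case (Suc n)
    have "(f ^^ Suc n) u - (f ^^ Suc n) v = c * ((f ^^ n) u - (f ^^ n) v)"
      by (simp add: cd algebra_simps)
    then show ?case
      by (simp add: Suc)
  qed simp
  have TT: "c ^ b * (T y - T z) = c ^ a * (y - z)"
    if "transit f a b (ball x (4 * r)) T" "z \<in> ball x (4*r)" "y \<in> ball x (4*r)" for a b T z y
    using that diff unfolding transit_def by metis
  show ?thesis
  proof (cases "c = 1")
    case True
    have "cmod (T y) \<le> M + 2 * r"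
      if T: "transit f a b (ball x (4 * r)) T" and z: "z \<in> ball x r" "cmod (T z) \<le> M" and y: "y \<in> ball x r"
      for a b T z y
    proof -
      have "T y = T z + (y - z)"
        using TT[OF T, of z y] z(1) y True r(1) by (auto simp: algebra_simps)
      moreover have "cmod (y - z) \<le> 2 * r"
        using y z(1) dist_triangle[of y z x] by (simp add: dist_norm norm_minus_commute)
      ultimately show ?thesis
        using z(2) norm_triangle_ineq[of "T z" "y - z"] by simp
    qed
    then show ?thesis using that by blast
  next
    case False
    define p where "p = d / (1 - c)"
    have "f p = p"
      using False by (simp add: cd p_def field_simps)
    then have pn: "(f ^^ n) p = p" for n
      by (induction n) auto
    then have "p \<in> Per f"
      unfolding Per_def by blast
    then have "p \<in> J_hat f"
      using Per_subset_J_hat by auto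
    then have pnot: "p \<notin> ball x (4 * r)"
      using r unfolding F_hat_def by auto
    have "cmod (T y) \<le> (M + cmod p) * (cmod x + r + cmod p) / r + cmod p"
      if T: "transit f a b (ball x (4 * r)) T" and z: "z \<in> ball x r" "cmod (T z) \<le> M" and y: "y \<in> ball x r"
      for a b T z y
    proof -
      \<comment> \<open>Cross-multiplying this identity at \<open>y\<close> and at \<open>z\<close>
        eliminates \<open>a\<close> and \<open>b\<close>. The fixed point \<open>p\<close> is
        outside the large ball, which keeps \<open>z - p\<close> away from 0.\<close>
      have Tp: "c ^ b * (T u - p) = c ^ a * (u - p)" if "u \<in> ball x (4*r)" for u
        using that diff[of a u p] diff[of b "T u" p] pn T unfolding transit_def by metis
      have "c ^ b * ((T y - p) * (z - p)) = c ^ b * ((T z - p) * (y - p))"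
        using Tp[of y] Tp[of z] y z(1) r(1) 
        by (simp only: mult.assoc[symmetric]) (simp add: mult_ac)
      then have eq: "(T y - p) * (z - p) = (T z - p) * (y - p)"
        using c0 by simp
      have zp: "r \<le> cmod (z - p)"
        using pnot z(1) dist_triangle[of x p z] r(1) by (simp add: dist_norm norm_minus_commute)
      have "cmod (T y - p) * r \<le> cmod (T y - p) * cmod (z - p)"
        using zp by (simp add: mult_left_mono)
      also have "\<dots> = cmod (T z - p) * cmod (y - p)"
        using eq by (metis norm_mult)
      also have "\<dots> \<le> (M + cmod p) * (cmod x + r + cmod p)"
      proof (rule mult_mono)
        show "cmod (T z - p) \<le> M + cmod p"
          using z(2) norm_triangle_ineq4[of "T z" p] by simp
        have "cmod y \<le> cmod x + r"
          using y norm_triangle_sub[of y x] by (simp add: dist_norm norm_minus_commute)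
        then show "cmod (y - p) \<le> cmod x + r + cmod p"
          using norm_triangle_ineq4[of y p] by simp
      qed (use z(2) norm_ge_zero[of "T z"] norm_ge_zero[of p] in \<open>linarith, simp\<close>)
      finally have "cmod (T y - p) \<le> (M + cmod p) * (cmod x + r + cmod p) / r"
        using r(1) by (simp add: field_simps)
      then show ?thesis
        using norm_triangle_sub[of "T y" p] by simp
    qed
    then show ?thesis using that by blast
  qed
qed

subsection \<open>The local dichotomy\<close>

definition GO_separated_at :: "(complex \<Rightarrow> complex) \<Rightarrow> complex \<Rightarrow> bool" where
  "GO_separated_at f z \<longleftrightarrow> (\<exists>U. open U \<and> z \<in> U \<and> (\<forall>z'\<in>U. GO f z' \<inter> U = {z'}))"

lemma GO_separated_at_isolated: "GO_separated_at f z \<Longrightarrow> z isolated_in GO f z"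
  unfolding GO_separated_at_def isolated_in_def by (metis GO_refl inf_commute)

lemma not_GO_separated_at_sequences:
  assumes bad: "\<not> GO_separated_at f x" and r: "r > 0"
  obtains y y' where "y \<longlonglongrightarrow> x" "y' \<longlonglongrightarrow> x" 
    "\<And>n. y n \<in> ball x r" "\<And>n. y' n \<in> ball x r" "\<And>n. y' n \<in> GO f (y n)" "\<And>n. y' n \<noteq> y n"
proof -
  define U where "U n = ball x (r / real (Suc n))" for n
  have "\<exists>v w. v \<in> U n \<and> w \<in> U n \<and> w \<in> GO f v \<and> w \<noteq> v" for n
  proof -
    have "open (U n)" "x \<in> U n"
      using r by (auto simp: U_def)
    then obtain v where "v \<in> U n" "GO f v \<inter> U n \<noteq> {v}"
      using bad unfolding GO_separated_at_def by blast
    then show ?thesis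
      using GO_refl[of v f] by blast
  qed
  then obtain y y' where y: "\<And>n. y n \<in> U n" "\<And>n. y' n \<in> U n" "\<And>n. y' n \<in> GO f (y n)" "\<And>n. y' n \<noteq> y n"
    by metis
  have lim: "v \<longlonglongrightarrow> x" if "\<And>n. v n \<in> U n" for v
  proof (rule metric_tendsto_imp_tendsto)
    show "(\<lambda>n. r / real (Suc n)) \<longlonglongrightarrow> 0"
      by real_asymp
    show "\<forall>\<^sub>F n in sequentially. dist (v n) x \<le> dist (r / real (Suc n)) 0"
      using that r by (auto simp: U_def dist_commute less_imp_le)
  qed
  have "U n \<subseteq> ball x r" for n
    unfolding U_def using r by (intro subset_ball) (auto simp: field_simps)
  then show ?thesis
    using that[of y y'] lim y by blast
qed

text \<open>Needed because the points moved by the transit maps vary with \<open>n\<close>.\<close>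

lemma uniform_limit_diagonal:
  fixes F :: "nat \<Rightarrow> 'a::metric_space \<Rightarrow> 'b::metric_space"
  assumes u: "uniform_limit K F g sequentially" and g: "continuous_on K g"
    and y: "y \<longlonglongrightarrow> x" "\<And>n. y n \<in> K" and x: "x \<in> K"
  shows "(\<lambda>n. F n (y n)) \<longlonglongrightarrow> g x"
proof (rule tendstoI)
  fix e :: real assume e: "e > 0"
  have "(\<lambda>n. g (y n)) \<longlonglongrightarrow> g x"
    by (rule continuous_on_tendsto_compose[OF g y(1) x]) (simp add: y(2))
  then have "\<forall>\<^sub>F n in sequentially. dist (g (y n)) (g x) < e / 2"
    using e half_gt_zero tendstoD by blast
  moreover have "\<forall>\<^sub>F n in sequentially. \<forall>v\<in>K. dist (F n v) (g v) < e / 2"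
    using u e half_gt_zero uniform_limitD by blast
  ultimately show "\<forall>\<^sub>F n in sequentially. dist (F n (y n)) (g x) < e"
  proof eventually_elim
    case (elim n)
    then show ?case
      using dist_triangle[of "F n (y n)" "g x" "g (y n)"] y(2)[of n] by fastforce
  qed
qed

text \<open>Failure at \<open>x\<close> spreads to a whole disc, which makes the set of
  non-separated points open. Points of one grand orbit close to \<open>x\<close> are joined by
  transit maps without fixed points, and these converge along a subsequence to the identity.\<close>

lemma not_GO_separated_at_spreads:
  assumes f: "f holomorphic_on UNIV" and x: "x \<in> F_hat f" and bad: "\<not> GO_separated_at f x"
  obtains r where "r > 0" "ball x r \<subseteq> F_hat f" "\<And>u. u \<in> ball x r \<Longrightarrow> \<not> u isolated_in GO f u"
proof -
  obtain s where s: "s > 0" "ball x s \<subseteq> F_hat f"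
    using open_F_hat x open_contains_ball by metis
  define r where "r = s / 4"
  have r: "r > 0" "ball x (4 * r) \<subseteq> F_hat f"
    using s by (auto simp: r_def)
  have sub: "ball x r \<subseteq> ball x (4 * r)"
    using r(1) by (intro subset_ball) auto
  \<comment> \<open>Half the radius keeps the points in a compact subdisc of
    \<open>ball x r\<close>, where the convergence will be uniform.\<close>
  obtain y y' where y: "y \<longlonglongrightarrow> x" "y' \<longlonglongrightarrow> x"  "\<And>n. y n \<in> ball x (r/2)" "\<And>n. y' n \<in> ball x (r/2)"
    "\<And>n. y' n \<in> GO f (y n)" "\<And>n. y' n \<noteq> y n"
    using not_GO_separated_at_sequences[OF bad, of "r/2"] r(1) by (metis half_gt_zero)
  have yr: "y n \<in> ball x r" for n
    using y(3)[of n] r(1) by auto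
  have "\<exists>T a b. transit f a b (ball x (4 * r)) T \<and> T (y n) = y' n" for n
  proof -
    obtain a b where ab: "(f ^^ a) (y n) = (f ^^ b) (y' n)"
      using y(5)[of n] by (auto simp: GO_def)
    obtain T where "transit f a b (ball x (4 * r)) T" "T (y n) = y' n"
      by (rule transit_exists[OF f open_ball convex_ball r(2) subsetD[OF sub yr] ab]) (rule that)
    then show ?thesis by blast
  qed
  then obtain T a b where T: "\<And>n. transit f (a n) (b n) (ball x (4 * r)) (T n)" "\<And>n. T n (y n) = y' n"
    by metis
  obtain K where K: "\<And>a b T z y. transit f a b (ball x (4 * r)) T \<Longrightarrow> z \<in> ball x r \<Longrightarrow>
      cmod (T z) \<le> cmod x + r \<Longrightarrow> y \<in> ball x r \<Longrightarrow> cmod (T y) \<le> K"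
    by (rule transit_bounded[OF f r]) (rule that)
  \<comment> \<open>Each \<open>T n\<close> has one value under control, namely \<open>y' n\<close>;
    \<open>transit_bounded\<close> turns this into a bound on the disc common to all
    \<open>n\<close>.\<close>
  have Ty: "cmod (T n (y n)) \<le> cmod x + r" for n
    using y(4)[of n] norm_triangle_sub[of "y' n" x] r(1) T(2)[of n] by (simp add: dist_norm norm_minus_commute)
  have bd: "cmod (T n v) \<le> K" if "v \<in> ball x r" for n v
    using K[OF T(1) yr Ty that] .
  have holT: "T n holomorphic_on ball x r" for n
    using T(1)[of n] sub holomorphic_on_subset unfolding transit_def by blast
  obtain g k where g: "g holomorphic_on ball x r" and k: "strict_mono (k :: nat \<Rightarrow> nat)"
    and lim: "\<And>v. v \<in> ball x r \<Longrightarrow> (\<lambda>n. T (k n) v) \<longlonglongrightarrow> g v"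
    and unif: "\<And>A. compact A \<Longrightarrow> A \<subseteq> ball x r \<Longrightarrow> uniform_limit A (T \<circ> k) g sequentially"
  proof (rule Montel[of "ball x r" "range T" T])
    show "\<exists>B. \<forall>h\<in>range T. \<forall>z\<in>A. cmod (h z) \<le> B" if "compact A" "A \<subseteq> ball x r" for A
      using bd that by (intro exI[of _ K]) auto
  qed (use holT in auto)
  have "(\<lambda>n. (T \<circ> k) n (y (k n))) \<longlonglongrightarrow> g x"
  proof (rule uniform_limit_diagonal[where F = "T \<circ> k" and g = g and K = "cball x (r/2)"])
    have A: "cball x (r/2) \<subseteq> ball x r"
      using r(1) by auto
    show "uniform_limit (cball x (r/2)) (T \<circ> k) g sequentially"
      by (rule unif[OF compact_cball A])
    show "continuous_on (cball x (r/2)) g"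
      by (rule continuous_on_subset[OF holomorphic_on_imp_continuous_on[OF g] A])
    show "(\<lambda>n. y (k n)) \<longlonglongrightarrow> x"
      using LIMSEQ_subseq_LIMSEQ[OF y(1) k] by (simp add: o_def)
    show "y (k n) \<in> cball x (r/2)" for n
      using y(3)[of "k n"] by (auto intro: less_imp_le)
  qed (use r(1) in auto)
  moreover have "(\<lambda>n. (T \<circ> k) n (y (k n))) \<longlonglongrightarrow> x"
    using LIMSEQ_subseq_LIMSEQ[OF y(2) k] by (simp add: o_def T(2))
  ultimately have gx: "g x = x"
    by (rule LIMSEQ_unique)
  have nofix: "T n v \<noteq> v" if "v \<in> ball x r" for n v
  proof
    assume "T n v = v"
    then have "T n (y n) = y n"
      using transit_fixpoint[OF f open_ball convex_connected[OF convex_ball] r(2) T(1)[of n], of v "y n"]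
        sub that yr by blast
    then show False
      using T(2) y(6) by metis
  qed
  have gid: "g u = u" if u: "u \<in> ball x r" for u
  proof (rule ccontr)
    assume nu: "g u \<noteq> u"
    \<comment> \<open>If \<open>g\<close> minus the identity were not constant, Hurwitz's theorem
      would make it zero-free like its approximants, although it vanishes at
      \<open>x\<close>.\<close>
    have "g x - x \<noteq> 0"
    proof (rule Hurwitz_no_zeros[of "ball x r" "\<lambda>n z. (T \<circ> k) n z - z" "\<lambda>z. g z - z"])
      show "(\<lambda>z. (T \<circ> k) n z - z) holomorphic_on ball x r" for n
        using holT by (auto intro!: holomorphic_intros)
      show "(\<lambda>z. g z - z) holomorphic_on ball x r"
        by (intro holomorphic_intros g)
      show "uniform_limit A (\<lambda>n z. (T \<circ> k) n z - z) (\<lambda>z. g z - z) sequentially"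
        if "compact A" "A \<subseteq> ball x r" for A
        by (intro uniform_limit_intros unif that)
      show "\<not> (\<lambda>z. g z - z) constant_on ball x r"
      proof
        assume "(\<lambda>z. g z - z) constant_on ball x r"
        then have "g u - u = g x - x"
          using u r(1) unfolding constant_on_def by (metis centre_in_ball)
        then show False
          using nu gx by simp
      qed
      show "(T \<circ> k) n z - z \<noteq> 0" if "z \<in> ball x r" for n z
        using nofix[OF that] by simp
    qed (use r(1) in auto)
    then show False
      using gx by simp
  qed
  have "\<not> u isolated_in GO f u" if u: "u \<in> ball x r" for u
  proof
    assume "u isolated_in GO f u"
    then obtain e where e: "e > 0" "\<And>v. v \<in> GO f u \<Longrightarrow> dist u v < e \<Longrightarrow> v = u"
      using isolated_in_dist_Ex_iff by metis
    have "\<forall>\<^sub>F n in sequentially. dist (T (k n) u) u < e"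
      using lim[OF u] gid[OF u] e(1) tendstoD by metis
    then obtain n where "dist (T (k n) u) u < e"
      using eventually_happens trivial_limit_sequentially by blast
    moreover have "T (k n) u \<in> GO f u"
      using transit_GO[OF T(1)] u sub by blast
    ultimately show False
      using e(2) nofix[OF u] by (metis dist_commute)
  qed
  then show ?thesis
    using that r sub by blast
qed

lemma isolated_imp_GO_separated_at:
  assumes "f holomorphic_on UNIV" "x \<in> F_hat f" "x isolated_in GO f x"
  shows "GO_separated_at f x"
proof (rule ccontr)
  assume "\<not> GO_separated_at f x"
  then obtain r where "r > 0" "\<And>u. u \<in> ball x r \<Longrightarrow> \<not> u isolated_in GO f u"
    by (rule not_GO_separated_at_spreads[OF assms(1,2)]) (rule that)
  then show False
    using assms(3) by simp
qed

text \<open>Separated points form an open set by definition, and non-separated points of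
  \<open>F_hat f\<close> form one by \<open>not_GO_separated_at_spreads\<close>; a connected
  \<open>C\<close> cannot meet both.\<close>

lemma GO_separated_at_component:
  assumes f: "f holomorphic_on UNIV" and C: "C \<in> components (F_hat f)"
    and x: "x \<in> C" "GO_separated_at f x" and y: "y \<in> C"
  shows "GO_separated_at f y"
proof (rule ccontr)
  assume bad: "\<not> GO_separated_at f y"
  have CF: "C \<subseteq> F_hat f" "connected C"
    using C in_components_subset in_components_connected by auto
  define N where "N = {z \<in> F_hat f. \<not> GO_separated_at f z}"
  have "open {z. GO_separated_at f z}"
    unfolding GO_separated_at_def by (subst open_subopen) blast
  moreover have "open N"
  proof (rule openI)
    fix z assume "z \<in> N"
    then obtain r where r: "r > 0" "ball z r \<subseteq> F_hat f" "\<And>u. u \<in> ball z r \<Longrightarrow> \<not> u isolated_in GO f u"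
      unfolding N_def using not_GO_separated_at_spreads[OF f] by (metis (lifting) mem_Collect_eq)
    then have "ball z r \<subseteq> N"
      using GO_separated_at_isolated unfolding N_def by blast
    then show "\<exists>e>0. ball z e \<subseteq> N"
      using r(1) by blast
  qed
  moreover have "C \<subseteq> {z. GO_separated_at f z} \<union> N" "{z. GO_separated_at f z} \<inter> N \<inter> C = {}"
    using CF by (auto simp: N_def)
  moreover have "{z. GO_separated_at f z} \<inter> C \<noteq> {}" "N \<inter> C \<noteq> {}"
    using x y bad CF by (auto simp: N_def)
  ultimately show False
    using connectedD[OF CF(2)] by blast
qed

text \<open>A transit map \<open>T\<close> from \<open>w\<close> to \<open>z\<close> sends points of
  \<open>GO f w\<close> near \<open>w\<close> to points of \<open>GO f z\<close> in
  \<open>U\<close>, hence to \<open>z\<close> itself. Local injectivity of \<open>f ^^ a\<close>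
  then identifies them with \<open>w\<close>, so \<open>w\<close> is isolated, which implies
  separated.\<close>

lemma GO_separated_at_GO:
  assumes f: "f holomorphic_on UNIV" and z: "z \<in> F_hat f" "GO_separated_at f z" and w: "w \<in> GO f z"
  shows "GO_separated_at f w"
proof -
  have wF: "w \<in> F_hat f"
    using F_hat_GO[OF f z(1) w] .
  obtain U where U: "open U" "z \<in> U" "\<And>v. v \<in> U \<Longrightarrow> GO f v \<inter> U = {v}"
    using z(2) by (auto simp: GO_separated_at_def)
  obtain r where r: "r > 0" "ball w r \<subseteq> F_hat f"
    using open_F_hat wF open_contains_ball by metis
  obtain a b where ab: "(f ^^ a) w = (f ^^ b) z"
    using GO_sym[OF w] by (auto simp: GO_def)
  obtain T where T: "transit f a b (ball w r) T" "T w = z"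
    using transit_exists[OF f open_ball convex_ball r(2) _ ab] r(1) by auto
  obtain s where s: "s > 0" "inj_on (f ^^ a) (ball w s)"
    using has_complex_derivative_locally_injective[OF holomorphic_on_funpow[OF f] UNIV_I open_UNIV deriv_funpow_nz[OF f wF]]
    by metis
  have "continuous_on (ball w r) T"
    using T(1) by (simp add: transit_def holomorphic_on_imp_continuous_on)
  then have op: "open (ball w r \<inter> T -` U)"
    using U(1) by (simp add: continuous_open_preimage)
  have "w isolated_in GO f w"
    unfolding isolated_in_def
  proof (intro conjI exI)
    let ?A = "(ball w r \<inter> T -` U) \<inter> ball w s"
    show "open ?A"
      using op by auto
    have "v = w" if v: "v \<in> ?A" "v \<in> GO f w" for v
    proof -
      have "T v \<in> GO f v"
        using transit_GO[OF T(1)] v by blast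
      moreover have "GO f v = GO f z"
        using v(2) w GO_eq by metis
      ultimately have "T v = z"
        using U v by blast
      then have "(f ^^ a) v = (f ^^ a) w"
        using T(1) v ab unfolding transit_def by (metis IntE)
      then show ?thesis
        using inj_onD[OF s(2)] v(1) s(1) by auto
    qed
    then show "?A \<inter> GO f w = {w}"
      using r(1) s(1) T(2) U(2) by auto
  qed auto
  then show ?thesis
    using isolated_imp_GO_separated_at[OF f wF] by blast
qed

subsection \<open>Wandering domains\<close>

lemma normal_family_onE:
  assumes "normal_family_on U \<F>" "range g \<subseteq> \<F>"
  obtains r h where "strict_mono (r :: nat \<Rightarrow> nat)"
    "\<And>K. compact K \<Longrightarrow> K \<subseteq> U \<Longrightarrow> uniform_limit K (\<lambda>k z. to_sphere (g (r k) z)) h sequentially"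
proof -
  have "\<exists>r h. strict_mono (r :: nat \<Rightarrow> nat) \<and> (\<forall>K. compact K \<and> K \<subseteq> U \<longrightarrow>
      uniform_limit K (\<lambda>k z. to_sphere (g (r k) z)) h sequentially)"
    using assms unfolding normal_family_on_def by (elim allE impE)
  then obtain r h where "strict_mono r" and h: "\<forall>K. compact K \<and> K \<subseteq> U \<longrightarrow>
      uniform_limit K (\<lambda>k z. to_sphere (g (r k) z)) h sequentially"
    by (elim exE conjE)
  then show ?thesis
    by (intro that[of r h]) auto
qed

text \<open>Composing a sequence of iterates with \<open>f\<close> gives iterates again, which are
  normal near \<open>z\<close>; convergence is pushed down to the image of a disc, a neighbourhood
  of \<open>f z\<close> by the open mapping theorem.\<close>

lemma Fatou_set_forward:
  assumes f: "f holomorphic_on UNIV" and nc: "\<not> f constant_on UNIV" and z: "z \<in> Fatou_set f"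
  shows "f z \<in> Fatou_set f"
proof -
  obtain U where U: "open U" "z \<in> U" "normal_family_on U (range (\<lambda>n. f ^^ n))"
    using z by (auto simp: Fatou_set_def)
  obtain e where e: "e > 0" "cball z e \<subseteq> U"
    using U open_contains_cball by metis
  let ?B = "f ` ball z e"
  have "normal_family_on ?B (range (\<lambda>n. f ^^ n))"
    unfolding normal_family_on_def
  proof (intro allI impI)
    fix g :: "nat \<Rightarrow> complex \<Rightarrow> complex"
    assume g: "range g \<subseteq> range (\<lambda>n. f ^^ n)"
    have "range (\<lambda>k. g k \<circ> f) \<subseteq> range (\<lambda>n. f ^^ n)"
    proof safe
      fix k
      obtain m where "g k = f ^^ m"
        using g by blast
      then have "g k \<circ> f = f ^^ Suc m"
        by (simp add: funpow_Suc_right del: funpow.simps)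
      then show "g k \<circ> f \<in> range (\<lambda>n. f ^^ n)"
        by blast
    qed
    from normal_family_onE[OF U(3) this]
    obtain r h where r: "strict_mono (r :: nat \<Rightarrow> nat)"
      and h: "\<And>K. compact K \<Longrightarrow> K \<subseteq> U \<Longrightarrow> uniform_limit K (\<lambda>k z. to_sphere ((g (r k) \<circ> f) z)) h sequentially"
      by metis
    \<comment> \<open>Any choice of preimages serves: uniform convergence on the compact disc
      \<open>cball z e\<close> gives uniform convergence on all of \<open>?B\<close>.\<close>
    define h' where "h' y = h (inv_into (ball z e) f y)" for y
    have "uniform_limit K (\<lambda>k z. to_sphere (g (r k) z)) h' sequentially" if K: "K \<subseteq> ?B" for K
    proof (rule uniform_limitI)
      fix \<epsilon> :: real assume "\<epsilon> > 0"
      then have "\<forall>\<^sub>F k in sequentially. \<forall>x\<in>cball z e. dist (to_sphere ((g (r k) \<circ> f) x)) (h x) < \<epsilon>"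
        using h[OF compact_cball e(2)] uniform_limitD by blast
      then show "\<forall>\<^sub>F k in sequentially. \<forall>y\<in>K. dist (to_sphere (g (r k) y)) (h' y) < \<epsilon>"
      proof eventually_elim
        case (elim k)
        show ?case
        proof
          fix y assume "y \<in> K"
          then have "y \<in> ?B"
            using K by blast
          then have "inv_into (ball z e) f y \<in> ball z e" "f (inv_into (ball z e) f y) = y"
            by (rule inv_into_into, rule f_inv_into_f)
          then show "dist (to_sphere (g (r k) y)) (h' y) < \<epsilon>"
            using elim[rule_format, of "inv_into (ball z e) f y"] by (simp add: h'_def)
        qed
      qed
    qed
    then show "\<exists>r h. strict_mono r \<and> (\<forall>K. compact K \<and> K \<subseteq> ?B \<longrightarrow>
        uniform_limit K (\<lambda>k z. to_sphere (g (r k) z)) h sequentially)"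
      using r by blast
  qed
  moreover have "open ?B"
    by (rule open_mapping_thm[OF f open_UNIV connected_UNIV open_ball subset_UNIV nc])
  ultimately show ?thesis
    using e(1) unfolding Fatou_set_def by (intro CollectI exI[of _ ?B]) auto
qed

text \<open>Every iterate except the identity factors as an iterate after \<open>f\<close>, so
  limits near \<open>f z\<close> pull back. A sequence containing the identity infinitely often has
  a constant subsequence.\<close>

lemma Fatou_set_backward:
  assumes f: "f holomorphic_on UNIV" and z: "f z \<in> Fatou_set f"
  shows "z \<in> Fatou_set f"
proof -
  have contf: "continuous_on UNIV f"
    by (rule holomorphic_on_imp_continuous_on[OF f])
  obtain U where U: "open U" "f z \<in> U" "normal_family_on U (range (\<lambda>n. f ^^ n))"
    using z by (auto simp: Fatou_set_def)
  have "normal_family_on (f -` U) (range (\<lambda>n. f ^^ n))"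
    unfolding normal_family_on_def
  proof (intro allI impI)
    fix g :: "nat \<Rightarrow> complex \<Rightarrow> complex"
    assume g: "range g \<subseteq> range (\<lambda>n. f ^^ n)"
    then have "\<forall>k. \<exists>m. g k = f ^^ m"
      by blast
    then obtain m where m: "\<And>k. g k = f ^^ m k"
      by metis
    show "\<exists>r h. strict_mono r \<and> (\<forall>K. compact K \<and> K \<subseteq> f -` U \<longrightarrow>
        uniform_limit K (\<lambda>k z. to_sphere (g (r k) z)) h sequentially)"
    proof (cases "infinite {k. m k = 0}")
      case True
      then obtain r where r: "strict_mono (r :: nat \<Rightarrow> nat)" "\<And>k. r k \<in> {k. m k = 0}"
        using infinite_enumerate by metis
      then have "g (r k) = id" for k
        by (simp add: m)
      then show ?thesis
        using r(1) by (intro exI[of _ r] exI[of _ to_sphere]) (auto intro: uniform_limit_const)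
    next
      case False
      \<comment> \<open>The truncated subtraction is harmless: \<open>m k = 0\<close> holds for
        finitely many \<open>k\<close> only, which \<open>ev\<close> discards.\<close>
      have "range (\<lambda>k. f ^^ (m k - 1)) \<subseteq> range (\<lambda>n. f ^^ n)"
        by blast
      from normal_family_onE[OF U(3) this]
      obtain r h where r: "strict_mono (r :: nat \<Rightarrow> nat)"
        and h: "\<And>K. compact K \<Longrightarrow> K \<subseteq> U \<Longrightarrow>
          uniform_limit K (\<lambda>k z. to_sphere ((f ^^ (m (r k) - 1)) z)) h sequentially"
        by metis
      have "\<forall>\<^sub>F k in sequentially. m k \<noteq> 0"
        using False by (simp add: eventually_cofinite cofinite_eq_sequentially[symmetric])
      then have ev: "\<forall>\<^sub>F k in sequentially. m (r k) \<noteq> 0"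
        using eventually_subseq[OF r] by blast
      have "uniform_limit K (\<lambda>k z. to_sphere (g (r k) z)) (\<lambda>z. h (f z)) sequentially"
        if K: "compact K" "K \<subseteq> f -` U" for K
      proof (rule uniform_limitI)
        fix \<epsilon> :: real assume "\<epsilon> > 0"
        have "compact (f ` K)" "f ` K \<subseteq> U"
          using K continuous_on_subset[OF contf] by (auto intro: compact_continuous_image)
        then have "\<forall>\<^sub>F k in sequentially. \<forall>y\<in>f ` K. dist (to_sphere ((f ^^ (m (r k) - 1)) y)) (h y) < \<epsilon>"
          using h \<open>\<epsilon> > 0\<close> uniform_limitD by blast
        with ev show "\<forall>\<^sub>F k in sequentially. \<forall>x\<in>K. dist (to_sphere (g (r k) x)) (h (f x)) < \<epsilon>"
        proof eventually_elim
          case (elim k)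
          then have "f ^^ m (r k) = (f ^^ (m (r k) - 1)) \<circ> f"
            using funpow_Suc_right[of "m (r k) - 1" f] by simp
          then show ?case
            using elim(2) by (simp add: m)
        qed
      qed
      then show ?thesis
        using r by blast
    qed
  qed
  moreover have "open (f -` U)"
    by (rule open_vimage[OF U(1) contf])
  ultimately show ?thesis
    using U(2) unfolding Fatou_set_def by (intro CollectI exI[of _ "f -` U"]) auto
qed

lemma Fatou_set_funpow_forward:
  assumes "f holomorphic_on UNIV" "\<not> f constant_on UNIV" "z \<in> Fatou_set f"
  shows "(f ^^ n) z \<in> Fatou_set f"
  using assms by (induction n) (auto intro: Fatou_set_forward)

lemma Fatou_set_GO:
  assumes f: "f holomorphic_on UNIV" "\<not> f constant_on UNIV" and z: "z \<in> Fatou_set f" and w: "w \<in> GO f z"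
  shows "w \<in> Fatou_set f"
proof -
  have bwd: "(f ^^ n) y \<in> Fatou_set f \<Longrightarrow> y \<in> Fatou_set f" for n y
    by (induction n) (auto intro: Fatou_set_backward[OF f(1)])
  obtain n m where "(f ^^ n) z = (f ^^ m) w"
    using w by (auto simp: GO_def)
  then show ?thesis
    using Fatou_set_funpow_forward[OF f z, of n] bwd[of m w] by simp
qed

section \<open>Fatou components along orbits\<close>

abbreviation Fatou_component_of :: "(complex \<Rightarrow> complex) \<Rightarrow> complex \<Rightarrow> complex set" where
  "Fatou_component_of f \<equiv> connected_component_set (Fatou_set f)"

lemma funpow_Fatou_component:
  assumes f: "f holomorphic_on UNIV" "\<not> f constant_on UNIV" and z: "z \<in> Fatou_set f"
  shows "(f ^^ n) ` Fatou_component_of f z \<subseteq> Fatou_component_of f ((f ^^ n) z)"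
proof (rule connected_component_maximal)
  show "(f ^^ n) z \<in> (f ^^ n) ` Fatou_component_of f z"
    using z by (simp add: connected_component_refl)
  show "connected ((f ^^ n) ` Fatou_component_of f z)"
    by (intro connected_continuous_image holomorphic_on_imp_continuous_on holomorphic_on_funpow f) auto
  show "(f ^^ n) ` Fatou_component_of f z \<subseteq> Fatou_set f"
    using Fatou_set_funpow_forward[OF f] connected_component_subset by blast
qed

lemma Fatou_component_funpow_eq:
  assumes f: "f holomorphic_on UNIV" "\<not> f constant_on UNIV" and z: "z \<in> Fatou_set f"
    and w: "w \<in> Fatou_component_of f z"
  shows "Fatou_component_of f ((f ^^ n) w) = Fatou_component_of f ((f ^^ n) z)"
  using funpow_Fatou_component[OF f z, of n] w connected_component_eq by blast

text \<open>Different times would put two different iterates of \<open>z\<close> into the same Fatou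
  component. That makes a component on the forward orbit of \<open>D\<close> periodic, so
  \<open>D\<close> would be preperiodic.\<close>

lemma wandering_orbit_times_eq:
  assumes f: "f holomorphic_on UNIV" "\<not> f constant_on UNIV" and D: "wandering_domain f D"
    and z: "z \<in> GO_set f D" and w: "w \<in> Fatou_component_of f z" 
    and eq: "(f ^^ n) z = (f ^^ m) w" and nm: "n \<noteq> m"
  shows False
proof -
  let ?C = "Fatou_component_of f"
  obtain d where d: "d \<in> D" "z \<in> GO f d"
    using z by (auto simp: GO_set_def)
  have DC: "D \<in> components (Fatou_set f)"
    using D by (simp add: wandering_domain_def)
  then have dF: "d \<in> Fatou_set f"
    using d(1) in_components_subset by blast
  have Dd: "D = ?C d"
    using DC d(1) by (metis components_iff connected_component_eq)
  obtain i j where ij: "(f ^^ i) d = (f ^^ j) z"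
    using d(2) by (auto simp: GO_def)
  have zF: "z \<in> Fatou_set f"
    using Fatou_set_GO[OF f dF d(2)] .
  have CC: "?C ((f ^^ n) z) = ?C ((f ^^ m) z)"
    using Fatou_component_funpow_eq[OF f zF w] eq by simp
  define a b where "a = min n m" and "b = max n m"
  have ab: "a < b" "?C ((f ^^ b) z) = ?C ((f ^^ a) z)"
    using nm CC by (auto simp: a_def b_def min_def max_def)
  \<comment> \<open>The further \<open>j\<close> steps are needed because the orbit of
    \<open>d\<close> is only known to meet that of \<open>z\<close> at
    \<open>(f ^^ j) z\<close>.\<close>
  let ?Q = "?C ((f ^^ j) ((f ^^ a) z))"
  have aF: "(f ^^ k) z \<in> Fatou_set f" for k
    by (rule Fatou_set_funpow_forward[OF f zF])
  have "(f ^^ b) z \<in> ?C ((f ^^ a) z)"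
    using ab(2) aF connected_component_refl_eq by (metis mem_Collect_eq)
  then have Qb: "?C ((f ^^ j) ((f ^^ b) z)) = ?Q"
    by (rule Fatou_component_funpow_eq[OF f aF])
  have QF: "(f ^^ j) ((f ^^ a) z) \<in> Fatou_set f"
    by (rule Fatou_set_funpow_forward[OF f aF])
  have "(f ^^ (b - a)) ((f ^^ j) ((f ^^ a) z)) = (f ^^ j) ((f ^^ b) z)"
  proof -
    have "(b - a) + (j + a) = j + b"
      using ab(1) by simp
    then show ?thesis
      by (metis comp_apply funpow_add)
  qed
  then have "(f ^^ (b - a)) ` ?Q \<subseteq> ?Q"
    using funpow_Fatou_component[OF f QF, of "b - a"] Qb by simp
  moreover have "?Q \<in> components (Fatou_set f)"
    using QF by (auto simp: components_def)
  ultimately have per: "periodic_component f ?Q"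
    using ab(1) unfolding periodic_component_def by (intro conjI exI[of _ "b - a"]) auto
  have "(f ^^ (a + i)) d = (f ^^ j) ((f ^^ a) z)"
    using ij by (metis add.commute comp_apply funpow_add)
  then have "(f ^^ (a + i)) ` D \<subseteq> ?Q"
    using funpow_Fatou_component[OF f dF, of "a + i"] Dd by simp
  then have "preperiodic_component f D"
    using per DC unfolding preperiodic_component_def by blast
  then show False
    using D by (simp add: wandering_domain_def)
qed

section \<open>The equivalences\<close>

theorem theoremA:
  fixes f :: "complex \<Rightarrow> complex" and C V :: "complex set"
  assumes "f holomorphic_on UNIV"
    and "C \<in> components (F_hat f)"
    and "V = GO_set f C"
  shows "(discrete_GO_relation f V \<longleftrightarrow> (\<exists>z\<in>V. discrete (GO f z)))
    \<and> (discrete_GO_relation f V \<longleftrightarrow>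
         (\<forall>z\<in>V. \<exists>U. open U \<and> z \<in> U \<and> (\<forall>z'\<in>U. GO f z' \<inter> U = {z'})))
    \<and> ((\<exists>D. wandering_domain f D \<and> V \<subseteq> GO_set f D) \<longrightarrow>
         (discrete_GO_relation f V \<longleftrightarrow>
           (\<exists>W. open W \<and> connected W \<and> W \<noteq> {} \<and> simply_connected W \<and> W \<subseteq> V \<and>
              (\<forall>n. inj_on f ((f ^^ n) ` W)))))"
proof -
  note f = assms(1)
  have CF: "C \<subseteq> F_hat f" "C \<noteq> {}" "open C"
    using assms(2) in_components_subset in_components_nonempty open_components[OF open_F_hat] by blast+
  have CV: "C \<subseteq> V"
    unfolding assms(3) GO_set_def using GO_refl by blast
  have VF: "v \<in> F_hat f" if "v \<in> V" for v
    using that CF(1) F_hat_GO[OF f] unfolding assms(3) GO_set_def by blast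
  have nc: "\<not> f constant_on UNIV"
    using CF not_constant_if_F_hat by blast
  \<comment> \<open>Separation travels from \<open>u\<close> to a representative in
    \<open>C\<close>, across the component \<open>C\<close>, and back out along the grand orbit to
    \<open>v\<close>.\<close>
  have spread: "GO_separated_at f v" if u: "u \<in> V" "GO_separated_at f u" and v: "v \<in> V" for u v
  proof -
    obtain c c' where c: "c \<in> C" "u \<in> GO f c" "c' \<in> C" "v \<in> GO f c'"
      using u(1) v unfolding assms(3) GO_set_def by blast
    have "GO_separated_at f c"
      using GO_separated_at_GO[OF f VF u(2) GO_sym] u(1) c(2) by blast
    then have "GO_separated_at f c'"
      using GO_separated_at_component[OF f assms(2)] c by blast
    then show ?thesis
      using GO_separated_at_GO[OF f VF] c CV by blast
  qed
  have all_separated: "\<forall>v\<in>V. GO_separated_at f v" if "u \<in> V" "u isolated_in GO f u" for u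
    using spread isolated_imp_GO_separated_at[OF f VF] that by blast
  have c_eq: "(\<forall>z\<in>V. \<exists>U. open U \<and> z \<in> U \<and> (\<forall>z'\<in>U. GO f z' \<inter> U = {z'})) \<longleftrightarrow> (\<forall>v\<in>V. GO_separated_at f v)"
    by (simp add: GO_separated_at_def)
  have ba: "\<forall>v\<in>V. GO_separated_at f v" if "z \<in> V" "discrete (GO f z)" for z
    using all_separated that unfolding discrete_def by (metis GO_refl)
  have ca: "discrete_GO_relation f V" if sep: "\<forall>v\<in>V. GO_separated_at f v"
    unfolding discrete_GO_relation_def discrete_def
  proof (intro ballI)
    fix z w assume zw: "z \<in> V" "w \<in> GO f z"
    then have "w \<in> V"
      using GO_set_closed unfolding assms(3) by metis
    then have "w isolated_in GO f w"
      using sep GO_separated_at_isolated by blast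
    then show "w isolated_in GO f z"
      using GO_eq[OF zw(2)] by simp
  qed
  obtain c where c: "c \<in> C"
    using CF by blast
  have ab: "\<exists>z\<in>V. discrete (GO f z)" if "discrete_GO_relation f V"
    using that c CV unfolding discrete_GO_relation_def by blast
  have cd: "\<exists>W. open W \<and> connected W \<and> W \<noteq> {} \<and> simply_connected W \<and> W \<subseteq> V \<and> (\<forall>n. inj_on f ((f ^^ n) ` W))"
    if sep: "\<forall>v\<in>V. GO_separated_at f v"
  proof -
    obtain U where U: "open U" "c \<in> U" "\<And>v. v \<in> U \<Longrightarrow> GO f v \<inter> U = {v}"
      using bspec[OF sep subsetD[OF CV c]] by (auto simp: GO_separated_at_def)
    then have "open (U \<inter> C)" "c \<in> U \<inter> C"
      using CF(3) c by auto
    then obtain e where e: "e > 0" "ball c e \<subseteq> U \<inter> C"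
      using open_contains_ball by metis
    \<comment> \<open>Two points of the disc with a common later iterate share a grand orbit, which
      meets \<open>U\<close> only once.\<close>
    have "inj_on f ((f ^^ n) ` ball c e)" for n
    proof (intro inj_onI)
      fix p q assume "p \<in> (f ^^ n) ` ball c e" "q \<in> (f ^^ n) ` ball c e" and pq: "f p = f q"
      then obtain x y where xy: "x \<in> ball c e" "y \<in> ball c e" "p = (f ^^ n) x" "q = (f ^^ n) y"
        by blast
      then have "(f ^^ Suc n) x = (f ^^ Suc n) y"
        using pq by simp
      then have "y \<in> GO f x"
        unfolding GO_def by blast
      then have "y = x"
        using U(3)[of x] xy e(2) by blast
      then show "p = q"
        using xy by simp
    qed
    then show ?thesis
      using e CV by (intro exI[of _ "ball c e"]) (auto intro: convex_imp_simply_connected)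
  qed
  have da: "\<forall>v\<in>V. GO_separated_at f v"
    if D: "wandering_domain f D" "V \<subseteq> GO_set f D"
      and W: "open W" "connected W" "W \<noteq> {}" "W \<subseteq> V" "\<And>n. inj_on f ((f ^^ n) ` W)" for D W
  proof -
    have injn: "inj_on (f ^^ n) W" for n
      using W(5) by (induction n) (auto intro: comp_inj_on)
    have "D \<subseteq> Fatou_set f"
      using D(1) in_components_subset by (auto simp: wandering_domain_def)
    then have VFat: "V \<subseteq> Fatou_set f"
      using D(2) Fatou_set_GO[OF f nc] unfolding GO_set_def by blast
    \<comment> \<open>The connected set \<open>W\<close> lies in one Fatou component, so the two
      times agree and injectivity of \<open>f ^^ n\<close> on \<open>W\<close> applies. Hence
      \<open>W\<close> itself is a separating neighbourhood of each of its points.\<close>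
    have uniq: "w = z" if zw: "z \<in> W" "w \<in> W" "w \<in> GO f z" for z w
    proof -
      obtain n m where nm: "(f ^^ n) z = (f ^^ m) w"
        using zw(3) by (auto simp: GO_def)
      have "w \<in> Fatou_component_of f z"
        using connected_component_maximal[OF zw(1) W(2)] zw(2) W(4) VFat by blast
      moreover have "z \<in> GO_set f D"
        using D(2) W(4) zw(1) by blast
      ultimately have "n = m"
        using wandering_orbit_times_eq[OF f nc D(1) _ _ nm] by blast
      then show ?thesis
        using nm injn[of n] zw by (auto simp: inj_on_def)
    qed
    obtain z where z: "z \<in> W"
      using W(3) by blast
    have "GO_separated_at f z"
      unfolding GO_separated_at_def using W(1) z uniq by (intro exI[of _ W]) auto
    then show ?thesis
      using spread z W(4) by blast
  qed
  show ?thesis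
    unfolding c_eq using ab ba ca cd da by blast
qed

end
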